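(* Let $L$ be the Fra\"iss\'e limit of the class of all finite nontrivial Heyting algebras. Then the topological group $\mathrm{Aut}(L)$ is not Roelcke precompact. A fortiori, $\mathrm{Aut}(L)$ cannot be realized as the automorphism group of any countable $\omega$-categorical structure; that is, there is no countable $\omega$-categorical structure $M$ such that $\mathrm{Aut}(M)$ is isomorphic to $\mathrm{Aut}(L)$ as a topological group.
   Context: Heyting algebras are structures in the language $\{0,1,\wedge,\vee,\to\}$; nontrivial means $0\neq 1$. The Fra\"iss\'e limit $L$ is the (unique up to isomorphism) countable Heyting algebra that is ultrahomogeneous (every isomorphism between finitely generated substructures of $L$ extends to an automorphism of $L$) and whose finitely generated substructures are, up to isomorphism, exactly the finite nontrivial Heyting algebras. It is known to exist. For a countable structure $M$, $\mathrm{Aut}(M)$ carries the topology of pointwise convergence, in which the pointwise stabilizers of finite subsets of $M$ form a neighbourhood basis of the identity. A non-archimedean topological group $G$ (one having a neighbourhood basis of the identity consisting of open subgroups) is Roelcke precompact if the set of double cosets $\{VxV \mid x\in G\}$ is finite for every open subgroup $V\le G$. *)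

theory Defs
  imports
    "HOL-Algebra.Bij"
    "HOL-Algebra.Coset"
    "HOL-Analysis.Function_Topology"
    "HOL-Analysis.Product_Topology"
begin

section \<open>First-order structures\<close>

text \<open>The symbols of a language form subsets of the symbol types, so that a language may have
  no relation symbols. Arities and interpretations outside of these subsets, and interpretations on
  arguments outside of the universe or of the wrong number, carry no meaning.\<close>

record ('f, 'r) language =
  funs :: "'f set"
  rels :: "'r set"
  farity :: "'f \<Rightarrow> nat"
  rarity :: "'r \<Rightarrow> nat"

definition countable_language :: "('f, 'r) language \<Rightarrow> bool"
  where "countable_language \<L> \<longleftrightarrow> countable (funs \<L>) \<and> countable (rels \<L>)"

record ('f, 'r, 'a) struct =
  universe :: "'a set"
  interp_fun :: "'f \<Rightarrow> 'a list \<Rightarrow> 'a"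
  interp_rel :: "'r \<Rightarrow> 'a list \<Rightarrow> bool"

definition arguments :: "('f, 'r, 'a) struct \<Rightarrow> nat \<Rightarrow> 'a list set"
  where "arguments M n = {xs. set xs \<subseteq> universe M \<and> length xs = n}"

definition is_struct :: "('f, 'r) language \<Rightarrow> ('f, 'r, 'a) struct \<Rightarrow> bool"
  where "is_struct \<L> M \<longleftrightarrow> universe M \<noteq> {} \<and>
    (\<forall>f\<in>funs \<L>. \<forall>xs\<in>arguments M (farity \<L> f). interp_fun M f xs \<in> universe M)"

definition isomorphism ::
    "('f, 'r) language \<Rightarrow> ('f, 'r, 'a) struct \<Rightarrow> ('f, 'r, 'b) struct \<Rightarrow> ('a \<Rightarrow> 'b) \<Rightarrow> bool"
  where "isomorphism \<L> M N h \<longleftrightarrow> bij_betw h (universe M) (universe N) \<and>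
    (\<forall>f\<in>funs \<L>. \<forall>xs\<in>arguments M (farity \<L> f).
       h (interp_fun M f xs) = interp_fun N f (map h xs)) \<and>
    (\<forall>r\<in>rels \<L>. \<forall>xs\<in>arguments M (rarity \<L> r).
       interp_rel M r xs \<longleftrightarrow> interp_rel N r (map h xs))"

definition isomorphic ::
    "('f, 'r) language \<Rightarrow> ('f, 'r, 'a) struct \<Rightarrow> ('f, 'r, 'b) struct \<Rightarrow> bool"
  where "isomorphic \<L> M N \<longleftrightarrow> (\<exists>h. isomorphism \<L> M N h)"

definition closed_subset :: "('f, 'r) language \<Rightarrow> ('f, 'r, 'a) struct \<Rightarrow> 'a set \<Rightarrow> bool"
  where "closed_subset \<L> M A \<longleftrightarrow> A \<subseteq> universe M \<and>
    (\<forall>f\<in>funs \<L>. \<forall>xs. set xs \<subseteq> A \<and> length xs = farity \<L> f \<longrightarrow> interp_fun M f xs \<in> A)"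

definition fg_substruct ::
    "('f, 'r) language \<Rightarrow> ('f, 'r, 'a) struct \<Rightarrow> ('f, 'r, 'a) struct \<Rightarrow> bool"
  where "fg_substruct \<L> M A \<longleftrightarrow> (\<exists>S. finite S \<and> S \<subseteq> universe M \<and>
    A = M\<lparr>universe := closed_subset \<L> M hull S\<rparr>)"

section \<open>Fraisse limits\<close>

definition ultrahomogeneous :: "('f, 'r) language \<Rightarrow> ('f, 'r, 'a) struct \<Rightarrow> bool"
  where "ultrahomogeneous \<L> M \<longleftrightarrow> (\<forall>A B h.
    fg_substruct \<L> M A \<and> fg_substruct \<L> M B \<and> isomorphism \<L> A B h \<longrightarrow>
    (\<exists>g. isomorphism \<L> M M g \<and> (\<forall>x\<in>universe A. g x = h x)))"

text \<open>The class of finite (or countable) structures whose Fraisse limit is considered is given by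
  its members with universe contained in the natural numbers; up to isomorphism there are no
  others.\<close>

definition age :: "('f, 'r) language \<Rightarrow> ('f, 'r, 'a) struct \<Rightarrow> ('f, 'r, nat) struct set"
  where "age \<L> M = {A. is_struct \<L> A \<and> (\<exists>B. fg_substruct \<L> M B \<and> isomorphic \<L> A B)}"

definition fraisse_limit ::
    "('f, 'r) language \<Rightarrow> ('f, 'r, nat) struct set \<Rightarrow> ('f, 'r, 'a) struct \<Rightarrow> bool"
  where "fraisse_limit \<L> \<C> M \<longleftrightarrow> is_struct \<L> M \<and> countable (universe M) \<and>
    ultrahomogeneous \<L> M \<and> age \<L> M = \<C>"

section \<open>Heyting algebras\<close>

datatype heyting_symbol = Zero | One | Meet | Join | Arrow

definition heyting_language :: "(heyting_symbol, unit) language"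
  where "heyting_language = \<lparr>funs = UNIV, rels = {},
    farity = (\<lambda>s. case s of Zero \<Rightarrow> 0 | One \<Rightarrow> 0 | Meet \<Rightarrow> 2 | Join \<Rightarrow> 2 | Arrow \<Rightarrow> 2),
    rarity = (\<lambda>_. 0)\<rparr>"

text \<open>The order is given by $x \le y \iff x \wedge y = x$; the last conjunct is the adjunction
  $z \wedge x \le y \iff z \le (x \to y)$.\<close>

definition heyting_algebra :: "(heyting_symbol, unit, 'a) struct \<Rightarrow> bool"
  where "heyting_algebra H \<longleftrightarrow> is_struct heyting_language H \<and>
    (let X = universe H;
         bot = interp_fun H Zero [];
         top = interp_fun H One [];
         meet = (\<lambda>x y. interp_fun H Meet [x, y]);
         join = (\<lambda>x y. interp_fun H Join [x, y]);
         arrow = (\<lambda>x y. interp_fun H Arrow [x, y]);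
         le = (\<lambda>x y. meet x y = x)
     in (\<forall>x\<in>X. \<forall>y\<in>X. \<forall>z\<in>X.
           meet (meet x y) z = meet x (meet y z) \<and> join (join x y) z = join x (join y z) \<and>
           meet x y = meet y x \<and> join x y = join y x \<and>
           meet x (join x y) = x \<and> join x (meet x y) = x \<and>
           le bot x \<and> le x top \<and>
           (le (meet z x) y \<longleftrightarrow> le z (arrow x y))))"

definition nontrivial :: "(heyting_symbol, unit, 'a) struct \<Rightarrow> bool"
  where "nontrivial H \<longleftrightarrow> interp_fun H Zero [] \<noteq> interp_fun H One []"

definition finite_nontrivial_heyting_algebras :: "(heyting_symbol, unit, nat) struct set"
  where "finite_nontrivial_heyting_algebras =
    {H. heyting_algebra H \<and> finite (universe H) \<and> nontrivial H}"

definition heyting_fraisse_limit :: "(heyting_symbol, unit, 'a) struct \<Rightarrow> bool"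
  where "heyting_fraisse_limit L \<longleftrightarrow> heyting_algebra L \<and>
    fraisse_limit heyting_language finite_nontrivial_heyting_algebras L"

section \<open>First-order formulas and categoricity in the countably infinite cardinal\<close>

datatype 'f trm = Var nat | App 'f "'f trm list"

datatype ('f, 'r) fm =
    Falsum
  | Eq "'f trm" "'f trm"
  | Rel 'r "'f trm list"
  | Imp "('f, 'r) fm" "('f, 'r) fm"
  | All nat "('f, 'r) fm"

primrec trm_in :: "('f, 'r) language \<Rightarrow> 'f trm \<Rightarrow> bool" where
  "trm_in \<L> (Var n) \<longleftrightarrow> True"
| "trm_in \<L> (App f ts) \<longleftrightarrow> f \<in> funs \<L> \<and> length ts = farity \<L> f \<and> list_all (trm_in \<L>) ts"

primrec fm_in :: "('f, 'r) language \<Rightarrow> ('f, 'r) fm \<Rightarrow> bool" where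
  "fm_in \<L> Falsum \<longleftrightarrow> True"
| "fm_in \<L> (Eq s t) \<longleftrightarrow> trm_in \<L> s \<and> trm_in \<L> t"
| "fm_in \<L> (Rel r ts) \<longleftrightarrow> r \<in> rels \<L> \<and> length ts = rarity \<L> r \<and> list_all (trm_in \<L>) ts"
| "fm_in \<L> (Imp \<phi> \<psi>) \<longleftrightarrow> fm_in \<L> \<phi> \<and> fm_in \<L> \<psi>"
| "fm_in \<L> (All n \<phi>) \<longleftrightarrow> fm_in \<L> \<phi>"

primrec vars_trm :: "'f trm \<Rightarrow> nat set" where
  "vars_trm (Var n) = {n}"
| "vars_trm (App f ts) = \<Union> (set (map vars_trm ts))"

primrec free_vars :: "('f, 'r) fm \<Rightarrow> nat set" where
  "free_vars Falsum = {}"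
| "free_vars (Eq s t) = vars_trm s \<union> vars_trm t"
| "free_vars (Rel r ts) = \<Union> (set (map vars_trm ts))"
| "free_vars (Imp \<phi> \<psi>) = free_vars \<phi> \<union> free_vars \<psi>"
| "free_vars (All n \<phi>) = free_vars \<phi> - {n}"

primrec trm_val :: "('f, 'r, 'a) struct \<Rightarrow> (nat \<Rightarrow> 'a) \<Rightarrow> 'f trm \<Rightarrow> 'a" where
  "trm_val M e (Var n) = e n"
| "trm_val M e (App f ts) = interp_fun M f (map (trm_val M e) ts)"

primrec sat :: "('f, 'r, 'a) struct \<Rightarrow> (nat \<Rightarrow> 'a) \<Rightarrow> ('f, 'r) fm \<Rightarrow> bool" where
  "sat M e Falsum \<longleftrightarrow> False"
| "sat M e (Eq s t) \<longleftrightarrow> trm_val M e s = trm_val M e t"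
| "sat M e (Rel r ts) \<longleftrightarrow> interp_rel M r (map (trm_val M e) ts)"
| "sat M e (Imp \<phi> \<psi>) \<longleftrightarrow> (sat M e \<phi> \<longrightarrow> sat M e \<psi>)"
| "sat M e (All n \<phi>) \<longleftrightarrow> (\<forall>a\<in>universe M. sat M (e(n := a)) \<phi>)"

definition models :: "('f, 'r, 'a) struct \<Rightarrow> ('f, 'r) fm \<Rightarrow> bool"
  where "models M \<phi> \<longleftrightarrow> (\<forall>e. range e \<subseteq> universe M \<longrightarrow> sat M e \<phi>)"

definition theory_of :: "('f, 'r) language \<Rightarrow> ('f, 'r, 'a) struct \<Rightarrow> ('f, 'r) fm set"
  where "theory_of \<L> M = {\<phi>. fm_in \<L> \<phi> \<and> free_vars \<phi> = {} \<and> models M \<phi>}"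

text \<open>Every countable structure has an isomorphic copy with universe contained in the natural
  numbers, so it suffices to let \<open>N\<close> range over those. A finite \<open>M\<close> is
  not excluded; for infinite \<open>M\<close> all models \<open>N\<close> of its theory are infinite.\<close>

definition omega_categorical :: "('f, 'r) language \<Rightarrow> ('f, 'r, 'a) struct \<Rightarrow> bool"
  where "omega_categorical \<L> M \<longleftrightarrow> countable (universe M) \<and>
    (\<forall>N :: ('f, 'r, nat) struct.
       is_struct \<L> N \<and> (\<forall>\<phi>\<in>theory_of \<L> M. models N \<phi>) \<longrightarrow> isomorphic \<L> M N)"

section \<open>Topological groups\<close>

definition topological_group :: "('g, 'm) monoid_scheme \<Rightarrow> 'g topology \<Rightarrow> bool"
  where "topological_group G T \<longleftrightarrow> group G \<and> topspace T = carrier G \<and>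
    continuous_map (prod_topology T T) T (\<lambda>(x, y). x \<otimes>\<^bsub>G\<^esub> y) \<and>
    continuous_map T T (\<lambda>x. inv\<^bsub>G\<^esub> x)"

definition non_archimedean :: "('g, 'm) monoid_scheme \<Rightarrow> 'g topology \<Rightarrow> bool"
  where "non_archimedean G T \<longleftrightarrow> topological_group G T \<and>
    (\<forall>U. openin T U \<and> \<one>\<^bsub>G\<^esub> \<in> U \<longrightarrow> (\<exists>V. subgroup V G \<and> openin T V \<and> V \<subseteq> U))"

text \<open>To be used for non-archimedean topological groups only.\<close>

definition roelcke_precompact :: "('g, 'm) monoid_scheme \<Rightarrow> 'g topology \<Rightarrow> bool"
  where "roelcke_precompact G T \<longleftrightarrow> (\<forall>V. subgroup V G \<and> openin T V \<longrightarrow>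
    finite {(V #>\<^bsub>G\<^esub> x) <#>\<^bsub>G\<^esub> V | x. x \<in> carrier G})"

definition isomorphic_topological_groups ::
    "('g, 'm) monoid_scheme \<Rightarrow> 'g topology \<Rightarrow> ('h, 'n) monoid_scheme \<Rightarrow> 'h topology \<Rightarrow> bool"
  where "isomorphic_topological_groups G T H U \<longleftrightarrow>
    (\<exists>\<phi>. \<phi> \<in> iso G H \<and> homeomorphic_map T U \<phi>)"

section \<open>The automorphism group\<close>

definition Aut :: "('f, 'r) language \<Rightarrow> ('f, 'r, 'a) struct \<Rightarrow> ('a \<Rightarrow> 'a) monoid"
  where "Aut \<L> M = BijGroup (universe M)
    \<lparr>carrier := {g \<in> Bij (universe M). isomorphism \<L> M M g}\<rparr>"

definition Aut_topology ::
    "('f, 'r) language \<Rightarrow> ('f, 'r, 'a) struct \<Rightarrow> ('a \<Rightarrow> 'a) topology"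
  where "Aut_topology \<L> M = subtopology
    (product_topology (\<lambda>_. discrete_topology (universe M)) (universe M)) (carrier (Aut \<L> M))"

definition stabilizer :: "('f, 'r) language \<Rightarrow> ('f, 'r, 'a) struct \<Rightarrow> 'a set \<Rightarrow> ('a \<Rightarrow> 'a) set"
  where "stabilizer \<L> M F = {g \<in> carrier (Aut \<L> M). \<forall>a\<in>F. g a = a}"

lemma carrier_Aut:
  "g \<in> carrier (Aut \<L> M) \<longleftrightarrow> g \<in> Bij (universe M) \<and> isomorphism \<L> M M g"
  by (simp add: Aut_def)

lemma one_Aut [simp]: "\<one>\<^bsub>Aut \<L> M\<^esub> = (\<lambda>x\<in>universe M. x)"
  by (simp add: Aut_def BijGroup_def)

lemma mult_Aut:
  assumes "g \<in> carrier (Aut \<L> M)" "h \<in> carrier (Aut \<L> M)"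
  shows "g \<otimes>\<^bsub>Aut \<L> M\<^esub> h = compose (universe M) g h"
  using assms by (simp add: Aut_def BijGroup_def)

lemma Aut_closed: "g \<in> carrier (Aut \<L> M) \<Longrightarrow> a \<in> universe M \<Longrightarrow> g a \<in> universe M"
  by (auto simp: carrier_Aut Bij_def bij_betw_def)

lemma map_compose_universe:
  "set xs \<subseteq> universe M \<Longrightarrow> map (compose (universe M) g h) xs = map g (map h xs)"
  by (auto simp: compose_def)

lemma isomorphism_compose:
  assumes M: "is_struct \<L> M"
    and g: "g \<in> Bij (universe M)" "isomorphism \<L> M M g"
    and h: "h \<in> Bij (universe M)" "isomorphism \<L> M M h"
  shows "isomorphism \<L> M M (compose (universe M) g h)"
proof -
  have b: "bij_betw (compose (universe M) g h) (universe M) (universe M)"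
    using compose_Bij[OF g(1) h(1)] by (simp add: Bij_def)
  have hx: "map h xs \<in> arguments M n" if "xs \<in> arguments M n" for xs n
    using that h(1) by (auto simp: arguments_def Bij_def bij_betw_def)
  have mc: "map (compose (universe M) g h) xs = map g (map h xs)" if "xs \<in> arguments M n" for xs n
    using that by (intro map_compose_universe) (simp add: arguments_def)
  show ?thesis
    unfolding isomorphism_def
  proof (intro conjI ballI b)
    fix f xs assume f: "f \<in> funs \<L>" and xs: "xs \<in> arguments M (farity \<L> f)"
    then have "interp_fun M f xs \<in> universe M" using M by (auto simp: is_struct_def)
    then have "compose (universe M) g h (interp_fun M f xs) = g (h (interp_fun M f xs))"
      by (simp add: compose_def)
    also have "\<dots> = interp_fun M f (map g (map h xs))"
      using g(2) h(2) f xs hx[OF xs] unfolding isomorphism_def by metis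
    finally show "compose (universe M) g h (interp_fun M f xs)
        = interp_fun M f (map (compose (universe M) g h) xs)"
      by (simp only: mc[OF xs])
  next
    fix r xs assume r: "r \<in> rels \<L>" and xs: "xs \<in> arguments M (rarity \<L> r)"
    show "interp_rel M r xs = interp_rel M r (map (compose (universe M) g h) xs)"
      using g(2) h(2) r xs hx[OF xs] mc[OF xs] unfolding isomorphism_def by metis
  qed
qed

lemma isomorphism_inverse:
  assumes M: "is_struct \<L> M"
    and g: "g \<in> Bij (universe M)" "isomorphism \<L> M M g"
  shows "isomorphism \<L> M M (restrict (inv_into (universe M) g) (universe M))" (is "isomorphism \<L> M M ?k")
proof -
  have b: "bij_betw g (universe M) (universe M)" using g(1) by (simp add: Bij_def)
  have bk: "bij_betw ?k (universe M) (universe M)"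
    using restrict_inv_into_Bij[OF g(1)] by (simp add: Bij_def)
  have gk: "g (?k x) = x" if "x \<in> universe M" for x
    using that b by (simp add: bij_betw_inv_into_right)
  have kg: "?k (g x) = x" if "x \<in> universe M" for x
    using that b by (simp add: bij_betw_inv_into_left bij_betwE)
  have kx: "map ?k xs \<in> arguments M n" if "xs \<in> arguments M n" for xs n
    using that bij_betwE[OF bk] by (auto simp: arguments_def)
  have gkx: "map g (map ?k xs) = xs" if "xs \<in> arguments M n" for xs n
    using that gk by (simp add: arguments_def subset_iff map_idI del: restrict_apply restrict_apply')
  show ?thesis
    unfolding isomorphism_def
  proof (intro conjI ballI bk)
    fix f xs assume f: "f \<in> funs \<L>" and xs: "xs \<in> arguments M (farity \<L> f)"
    have "interp_fun M f (map ?k xs) \<in> universe M" using M f kx[OF xs] by (auto simp: is_struct_def)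
    moreover have "g (interp_fun M f (map ?k xs)) = interp_fun M f xs"
      using g(2) f kx[OF xs] gkx[OF xs] unfolding isomorphism_def by metis
    ultimately show "?k (interp_fun M f xs) = interp_fun M f (map ?k xs)"
      using kg by metis
  next
    fix r xs assume r: "r \<in> rels \<L>" and xs: "xs \<in> arguments M (rarity \<L> r)"
    show "interp_rel M r xs = interp_rel M r (map ?k xs)"
      using g(2) r kx[OF xs] gkx[OF xs] unfolding isomorphism_def by metis
  qed
qed

lemma inv_Aut_aux:
  assumes "is_struct \<L> M" "g \<in> carrier (Aut \<L> M)"
  shows "restrict (inv_into (universe M) g) (universe M) \<in> carrier (Aut \<L> M)"
    and "restrict (inv_into (universe M) g) (universe M) \<otimes>\<^bsub>Aut \<L> M\<^esub> g = \<one>\<^bsub>Aut \<L> M\<^esub>"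
proof -
  show c: "restrict (inv_into (universe M) g) (universe M) \<in> carrier (Aut \<L> M)"
    using assms isomorphism_inverse restrict_inv_into_Bij by (fastforce simp: carrier_Aut)
  show "restrict (inv_into (universe M) g) (universe M) \<otimes>\<^bsub>Aut \<L> M\<^esub> g = \<one>\<^bsub>Aut \<L> M\<^esub>"
    using assms c by (simp add: mult_Aut Bij_compose_restrict_eq carrier_Aut)
qed

lemma group_Aut:
  assumes "is_struct \<L> M" shows "group (Aut \<L> M)"
proof (rule groupI)
  fix x y assume "x \<in> carrier (Aut \<L> M)" "y \<in> carrier (Aut \<L> M)"
  then show "x \<otimes>\<^bsub>Aut \<L> M\<^esub> y \<in> carrier (Aut \<L> M)"
    by (auto simp: mult_Aut carrier_Aut compose_Bij isomorphism_compose[OF assms])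
next
  have m: "map (\<lambda>x\<in>universe M. x) xs = xs" if "xs \<in> arguments M n" for xs n
    using that by (intro map_idI) (auto simp: arguments_def)
  have "bij_betw (\<lambda>x\<in>universe M. x) (universe M) (universe M)"
    using id_Bij[of "universe M"] by (simp add: Bij_def)
  then have "isomorphism \<L> M M (\<lambda>x\<in>universe M. x)"
    using assms by (simp add: isomorphism_def is_struct_def m)
  then show "\<one>\<^bsub>Aut \<L> M\<^esub> \<in> carrier (Aut \<L> M)"
    by (simp add: carrier_Aut id_Bij)
next
  interpret B: group "BijGroup (universe M)" by (rule group_BijGroup)
  fix x y z
  assume a: "x \<in> carrier (Aut \<L> M)" "y \<in> carrier (Aut \<L> M)" "z \<in> carrier (Aut \<L> M)"
  then show "x \<otimes>\<^bsub>Aut \<L> M\<^esub> y \<otimes>\<^bsub>Aut \<L> M\<^esub> z = x \<otimes>\<^bsub>Aut \<L> M\<^esub> (y \<otimes>\<^bsub>Aut \<L> M\<^esub> z)"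
    using B.m_assoc[of x y z] by (simp add: Aut_def BijGroup_def)
next
  interpret B: group "BijGroup (universe M)" by (rule group_BijGroup)
  fix x assume "x \<in> carrier (Aut \<L> M)"
  then show "\<one>\<^bsub>Aut \<L> M\<^esub> \<otimes>\<^bsub>Aut \<L> M\<^esub> x = x"
    using B.l_one[of x] by (simp add: Aut_def BijGroup_def)
next
  fix x assume "x \<in> carrier (Aut \<L> M)"
  then show "\<exists>y\<in>carrier (Aut \<L> M). y \<otimes>\<^bsub>Aut \<L> M\<^esub> x = \<one>\<^bsub>Aut \<L> M\<^esub>"
    using inv_Aut_aux[OF assms] by blast
qed

lemma inv_Aut_apply:
  assumes "is_struct \<L> M" "g \<in> carrier (Aut \<L> M)" "a \<in> universe M"
  shows "(inv\<^bsub>Aut \<L> M\<^esub> g) a = inv_into (universe M) g a"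
proof -
  interpret group "Aut \<L> M" by (rule group_Aut[OF assms(1)])
  have "inv\<^bsub>Aut \<L> M\<^esub> g = restrict (inv_into (universe M) g) (universe M)"
    by (intro inv_equality inv_Aut_aux assms)
  then show ?thesis using assms(3) by simp
qed

lemma topspace_Aut [simp]: "topspace (Aut_topology \<L> M) = carrier (Aut \<L> M)"
proof -
  have "carrier (Aut \<L> M) \<subseteq> universe M \<rightarrow>\<^sub>E universe M"
  proof
    fix g assume "g \<in> carrier (Aut \<L> M)"
    then show "g \<in> universe M \<rightarrow>\<^sub>E universe M"
      using Aut_closed[of g \<L> M] by (simp add: PiE_def Pi_def carrier_Aut Bij_def)
  qed
  then show ?thesis by (auto simp: Aut_topology_def)
qed

lemma openin_Aut_topology:
  "openin (Aut_topology \<L> M) W \<longleftrightarrow> W \<subseteq> carrier (Aut \<L> M) \<and>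
    (\<forall>g\<in>W. \<exists>F. finite F \<and> F \<subseteq> universe M \<and>
       {h \<in> carrier (Aut \<L> M). \<forall>a\<in>F. h a = g a} \<subseteq> W)"  (is "?L \<longleftrightarrow> ?R")
proof
  assume ?L
  then obtain U where
      U: "openin (product_topology (\<lambda>_. discrete_topology (universe M)) (universe M)) U"
    and W: "W = U \<inter> carrier (Aut \<L> M)"
    by (auto simp: Aut_topology_def openin_subtopology)
  show ?R
  proof (intro conjI ballI)
    show "W \<subseteq> carrier (Aut \<L> M)" using W by simp
    fix g assume "g \<in> W"
    then have "g \<in> U" using W by simp
    then obtain V where V: "finite {i \<in> universe M. V i \<noteq> universe M}" "g \<in> Pi\<^sub>E (universe M) V"
        "Pi\<^sub>E (universe M) V \<subseteq> U"
      using U unfolding openin_product_topology_alt by (auto simp: topspace_discrete_topology)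
    let ?F = "{i \<in> universe M. V i \<noteq> universe M}"
    have "h \<in> W" if h: "h \<in> carrier (Aut \<L> M)" "\<forall>a\<in>?F. h a = g a" for h
    proof -
      have "h a \<in> V a" if "a \<in> universe M" for a
        using that h V(2) Aut_closed[OF h(1) that] by (cases "V a = universe M") (auto simp: PiE_def)
      moreover have "h \<in> extensional (universe M)"
        using h(1) by (simp add: carrier_Aut Bij_def)
      ultimately have "h \<in> Pi\<^sub>E (universe M) V" by (simp add: PiE_def)
      then show ?thesis using V(3) W h(1) by auto
    qed
    then show "\<exists>F. finite F \<and> F \<subseteq> universe M \<and> {h \<in> carrier (Aut \<L> M). \<forall>a\<in>F. h a = g a} \<subseteq> W"
      using V(1) by (intro exI[of _ ?F]) auto
  qed
next
  assume R: ?R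
  show ?L
  proof (subst openin_subopen, intro ballI)
    fix g assume g: "g \<in> W"
    then obtain F where F: "finite F" "F \<subseteq> universe M"
        "{h \<in> carrier (Aut \<L> M). \<forall>a\<in>F. h a = g a} \<subseteq> W"
      using R by blast
    have gA: "g \<in> carrier (Aut \<L> M)" using R g by blast
    define V where "V a = (if a \<in> F then {g a} else universe M)" for a
    have "finite {i \<in> universe M. V i \<noteq> universe M}"
      by (rule finite_subset[OF _ F(1)]) (auto simp: V_def)
    moreover have "V i \<subseteq> universe M" if "i \<in> universe M" for i
      using Aut_closed[OF gA that] by (simp add: V_def)
    ultimately have "openin (product_topology (\<lambda>_. discrete_topology (universe M)) (universe M))
        (Pi\<^sub>E (universe M) V)"
      by (simp add: openin_PiE_gen)
    then have o: "openin (Aut_topology \<L> M) (Pi\<^sub>E (universe M) V \<inter> carrier (Aut \<L> M))"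
      by (auto simp: Aut_topology_def openin_subtopology)
    have "g \<in> Pi\<^sub>E (universe M) V"
      using gA Aut_closed[OF gA] by (auto simp: V_def PiE_def carrier_Aut Bij_def)
    moreover have "Pi\<^sub>E (universe M) V \<inter> carrier (Aut \<L> M) \<subseteq> W"
    proof
      fix h assume h: "h \<in> Pi\<^sub>E (universe M) V \<inter> carrier (Aut \<L> M)"
      have "h a = g a" if "a \<in> F" for a
      proof -
        have "h a \<in> V a" using h that F(2) by (auto simp: PiE_def)
        then show ?thesis using that by (simp add: V_def)
      qed
      then show "h \<in> W" using F(3) h by blast
    qed
    ultimately show "\<exists>T. openin (Aut_topology \<L> M) T \<and> g \<in> T \<and> T \<subseteq> W"
      using o gA by blast
  qed
qed

lemma openin_Aut_basic:
  assumes "finite F" "F \<subseteq> universe M"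
  shows "openin (Aut_topology \<L> M) {h \<in> carrier (Aut \<L> M). \<forall>a\<in>F. h a = b a}"
  unfolding openin_Aut_topology using assms by fastforce

lemma topological_group_Aut:
  assumes M: "is_struct \<L> M"
  shows "topological_group (Aut \<L> M) (Aut_topology \<L> M)"
proof -
  let ?T = "Aut_topology \<L> M" and ?G = "Aut \<L> M"
  interpret group ?G by (rule group_Aut[OF M])
  have "continuous_map (prod_topology ?T ?T) ?T (\<lambda>(x, y). x \<otimes>\<^bsub>?G\<^esub> y)"
    unfolding continuous_map_def
  proof (intro conjI allI impI)
    show "(\<lambda>(x, y). x \<otimes>\<^bsub>?G\<^esub> y) \<in> topspace (prod_topology ?T ?T) \<rightarrow> topspace ?T"
      by auto
    fix U assume U: "openin ?T U"
    show "openin (prod_topology ?T ?T)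
        {p \<in> topspace (prod_topology ?T ?T). (case p of (x, y) \<Rightarrow> x \<otimes>\<^bsub>?G\<^esub> y) \<in> U}"
      unfolding openin_prod_topology_alt
    proof (intro allI impI)
      fix x y
      assume "(x, y) \<in> {p \<in> topspace (prod_topology ?T ?T). (case p of (x, y) \<Rightarrow> x \<otimes>\<^bsub>?G\<^esub> y) \<in> U}"
      then have x: "x \<in> carrier ?G" and y: "y \<in> carrier ?G" and xy: "x \<otimes>\<^bsub>?G\<^esub> y \<in> U" by auto
      obtain F where F: "finite F" "F \<subseteq> universe M"
          "{h \<in> carrier ?G. \<forall>a\<in>F. h a = (x \<otimes>\<^bsub>?G\<^esub> y) a} \<subseteq> U"
        using U xy unfolding openin_Aut_topology by blast
      let ?A = "{h \<in> carrier ?G. \<forall>a\<in>y ` F. h a = x a}"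
      let ?B = "{h \<in> carrier ?G. \<forall>a\<in>F. h a = y a}"
      have "y ` F \<subseteq> universe M"
        using F(2) Aut_closed[OF y] by auto
      then have "openin ?T ?A" "openin ?T ?B"
        using openin_Aut_basic[of "y ` F" M \<L> x] openin_Aut_basic[of F M \<L> y] F(1,2)
        by simp_all
      moreover have "u \<otimes>\<^bsub>?G\<^esub> v \<in> U" if u: "u \<in> ?A" and v: "v \<in> ?B" for u v
      proof -
        have "(u \<otimes>\<^bsub>?G\<^esub> v) a = (x \<otimes>\<^bsub>?G\<^esub> y) a" if "a \<in> F" for a
          using that u v x y F(2) by (auto simp: mult_Aut compose_def)
        then show ?thesis using u v F(3) by blast
      qed
      ultimately show "\<exists>A B. openin ?T A \<and> openin ?T B \<and> x \<in> A \<and> y \<in> B \<and> A \<times> B \<subseteq>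
          {p \<in> topspace (prod_topology ?T ?T). (case p of (x, y) \<Rightarrow> x \<otimes>\<^bsub>?G\<^esub> y) \<in> U}"
        using x y by (intro exI[of _ ?A] exI[of _ ?B]) auto
    qed
  qed
  moreover have "continuous_map ?T ?T (\<lambda>x. inv\<^bsub>?G\<^esub> x)"
    unfolding continuous_map_def
  proof (intro conjI allI impI)
    show "(\<lambda>x. inv\<^bsub>?G\<^esub> x) \<in> topspace ?T \<rightarrow> topspace ?T" by auto
    fix U assume U: "openin ?T U"
    show "openin ?T {x \<in> topspace ?T. inv\<^bsub>?G\<^esub> x \<in> U}"
      unfolding openin_Aut_topology
    proof (intro conjI ballI)
      fix x assume "x \<in> {x \<in> topspace ?T. inv\<^bsub>?G\<^esub> x \<in> U}"
      then have x: "x \<in> carrier ?G" and ix: "inv\<^bsub>?G\<^esub> x \<in> U" by auto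
      obtain F where F: "finite F" "F \<subseteq> universe M"
          "{h \<in> carrier ?G. \<forall>a\<in>F. h a = (inv\<^bsub>?G\<^esub> x) a} \<subseteq> U"
        using U ix unfolding openin_Aut_topology by blast
      have bij: "bij_betw h (universe M) (universe M)" if "h \<in> carrier ?G" for h
        using that by (simp add: carrier_Aut Bij_def)
      let ?F = "(inv\<^bsub>?G\<^esub> x) ` F"
      have "inv\<^bsub>?G\<^esub> h \<in> U" if h: "h \<in> carrier ?G" "\<forall>a\<in>?F. h a = x a" for h
      proof -
        have "(inv\<^bsub>?G\<^esub> h) a = (inv\<^bsub>?G\<^esub> x) a" if a: "a \<in> F" for a
        proof -
          have aM: "a \<in> universe M" using a F(2) by blast
          have "(inv\<^bsub>?G\<^esub> x) a \<in> universe M" by (rule Aut_closed[OF inv_closed[OF x] aM])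
          moreover have "h ((inv\<^bsub>?G\<^esub> x) a) = a"
          proof -
            have "h ((inv\<^bsub>?G\<^esub> x) a) = x ((inv\<^bsub>?G\<^esub> x) a)" using h(2) a by blast
            also have "\<dots> = a"
              using bij[OF x] aM by (simp add: inv_Aut_apply[OF M x aM] bij_betw_inv_into_right)
            finally show ?thesis .
          qed
          ultimately show ?thesis
            using bij_betw_inv_into_left[OF bij[OF h(1)]] inv_Aut_apply[OF M h(1) aM] by metis
        qed
        then show ?thesis using F(3) h(1) by blast
      qed
      moreover have "?F \<subseteq> universe M" using F(2) Aut_closed[OF inv_closed[OF x]] by auto
      ultimately show "\<exists>F. finite F \<and> F \<subseteq> universe M \<and> {h \<in> carrier ?G. \<forall>a\<in>F. h a = x a} \<subseteq>
          {x \<in> topspace ?T. inv\<^bsub>?G\<^esub> x \<in> U}"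
        using F(1) by (intro exI[of _ ?F]) auto
    qed auto
  qed
  ultimately show ?thesis by (simp add: topological_group_def group_axioms)
qed

lemma subgroup_stabilizer:
  assumes M: "is_struct \<L> M" and F: "F \<subseteq> universe M"
  shows "subgroup (stabilizer \<L> M F) (Aut \<L> M)"
proof -
  interpret group "Aut \<L> M" by (rule group_Aut[OF M])
  show ?thesis
  proof (rule subgroupI)
    show "stabilizer \<L> M F \<noteq> {}"
      using one_closed F by (force simp: stabilizer_def)
    fix a assume a: "a \<in> stabilizer \<L> M F"
    have "inv_into (universe M) a x = x" if "x \<in> F" for x
      using a that F bij_betw_inv_into_left[of a "universe M" "universe M" x]
      by (auto simp: stabilizer_def carrier_Aut Bij_def)
    then show "inv\<^bsub>Aut \<L> M\<^esub> a \<in> stabilizer \<L> M F"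
      using a F by (auto simp: stabilizer_def inv_Aut_apply[OF M] subset_iff)
  next
    fix a b assume "a \<in> stabilizer \<L> M F" "b \<in> stabilizer \<L> M F"
    moreover from this have "a \<otimes>\<^bsub>Aut \<L> M\<^esub> b \<in> carrier (Aut \<L> M)" by (simp add: stabilizer_def)
    ultimately show "a \<otimes>\<^bsub>Aut \<L> M\<^esub> b \<in> stabilizer \<L> M F"
      using F by (auto simp: stabilizer_def mult_Aut compose_def subset_iff)
  qed (auto simp: stabilizer_def)
qed

lemma openin_stabilizer:
  "finite F \<Longrightarrow> F \<subseteq> universe M \<Longrightarrow> openin (Aut_topology \<L> M) (stabilizer \<L> M F)"
  unfolding stabilizer_def by (rule openin_Aut_basic)

lemma stabilizer_neighbourhood_basis:
  assumes "openin (Aut_topology \<L> M) U" "\<one>\<^bsub>Aut \<L> M\<^esub> \<in> U"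
  shows "\<exists>F. finite F \<and> F \<subseteq> universe M \<and> stabilizer \<L> M F \<subseteq> U"
proof -
  obtain F where F: "finite F" "F \<subseteq> universe M"
      "{h \<in> carrier (Aut \<L> M). \<forall>a\<in>F. h a = \<one>\<^bsub>Aut \<L> M\<^esub> a} \<subseteq> U"
    using assms unfolding openin_Aut_topology by blast
  moreover have "\<one>\<^bsub>Aut \<L> M\<^esub> a = a" if "a \<in> F" for a
    using that F(2) by auto
  ultimately have "stabilizer \<L> M F \<subseteq> U" by (simp add: stabilizer_def del: one_Aut)
  then show ?thesis using F(1,2) by blast
qed

lemma non_archimedean_Aut:
  "is_struct \<L> M \<Longrightarrow> non_archimedean (Aut \<L> M) (Aut_topology \<L> M)"
  unfolding non_archimedean_def
  by (auto intro!: topological_group_Aut dest!: stabilizer_neighbourhood_basis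
      intro: subgroup_stabilizer openin_stabilizer)

end

theory Submission
  imports Defs
begin

text \<open>Let \<open>V\<close> be the stabilizer of a dense element \<open>a\<close> of \<open>L\<close> (that is, \<open>\<not> a = 0\<close> and \<open>a \<noteq> 0, 1\<close>). All dense
  elements generate a three-element chain, so they are conjugate by ultrahomogeneity, and \<open>V x V\<close>
  determines the isomorphism type of the substructure generated by \<open>a\<close> and \<open>x a\<close>. Two dense elements
  can generate arbitrarily large finite Heyting algebras: over a new bottom element, the first one
  plays the role of 0 and the second one that of the generator of a finite quotient of the
  Rieger--Nishimura lattice. Hence there are infinitely many double cosets.

  On the other hand, if \<open>M\<close> is \<open>\<omega>\<close>-categorical then \<open>Aut M\<close> is Roelcke precompact. By an ultrapower and a
  Loewenheim--Skolem argument, \<open>M\<close> realises every finitely satisfiable countable set of formulas.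
  Since \<open>M\<close> is countable, isolated types are therefore dense, and an elementary substructure all of
  whose finite tuples have isolated types can be chosen inside \<open>M\<close>. It is isomorphic to \<open>M\<close>, so all
  types are isolated, there are finitely many of them in each arity, and tuples of the same type are
  conjugate by a back-and-forth argument.\<close>

section \<open>Formulas\<close>

text \<open>That \<open>L\<close> itself is not \<open>\<omega>\<close>-categorical is easy: its
  elements generate finite algebras of unboundedly many sizes, so there are infinitely many orbits
  on \<open>L\<close>. This says nothing about the group, which might also act on another structure
  with few orbits; Roelcke precompactness compares only pairs of tuples taken from one and the same
  orbit. So conjugate elements are needed that still generate large algebras. Density is chosen
  because it fixes every operation on 0, a, 1 and hence puts all such elements into one orbit, while
  a pair of dense elements keeps the freedom of a one-generated Heyting algebra. For
  \<open>M\<close>, categoricity serves to identify other countable models with \<open>M\<close>,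
  and this happens twice: with a model realising prescribed formulas, and with a model having only
  isolated types. Both are used in the end: if there were infinitely many isolated types,
  compactness would produce a tuple avoiding all of them. Types occur only through formulas
  isolating them, since no others survive.\<close>

abbreviation fm_true :: "('f, 'r) fm" where "fm_true \<equiv> Imp Falsum Falsum"
abbreviation fm_neg :: "('f, 'r) fm \<Rightarrow> ('f, 'r) fm" where "fm_neg \<phi> \<equiv> Imp \<phi> Falsum"
abbreviation fm_conj :: "('f, 'r) fm \<Rightarrow> ('f, 'r) fm \<Rightarrow> ('f, 'r) fm"
  where "fm_conj \<phi> \<psi> \<equiv> fm_neg (Imp \<phi> (fm_neg \<psi>))"
abbreviation fm_ex :: "nat \<Rightarrow> ('f, 'r) fm \<Rightarrow> ('f, 'r) fm"
  where "fm_ex n \<phi> \<equiv> fm_neg (All n (fm_neg \<phi>))"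

section \<open>Assignments and renaming of variables\<close>

lemma trm_val_cong: "(\<And>i. i \<in> vars_trm t \<Longrightarrow> e i = e' i) \<Longrightarrow> trm_val M e t = trm_val M e' t"
proof (induction t)
  case (App f ts)
  then have "map (trm_val M e) ts = map (trm_val M e') ts" by (auto intro!: map_cong)
  then show ?case by (simp del: map_eq_conv)
qed simp

lemma sat_cong: "(\<And>i. i \<in> free_vars \<phi> \<Longrightarrow> e i = e' i) \<Longrightarrow> sat M e \<phi> = sat M e' \<phi>"
proof (induction \<phi> arbitrary: e e')
  case (Eq s t)
  then show ?case using trm_val_cong[of s e e' M] trm_val_cong[of t e e' M] by auto
next
  case (Rel r ts)
  then have "map (trm_val M e) ts = map (trm_val M e') ts"
    by (auto intro!: map_cong trm_val_cong)
  then show ?case by (simp del: map_eq_conv)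
next
  case (Imp \<phi> \<psi>)
  have "sat M e \<phi> = sat M e' \<phi>" "sat M e \<psi> = sat M e' \<psi>"
    using Imp.prems by (auto intro!: Imp.IH)
  then show ?case by simp
next
  case (All n \<phi>)
  have "sat M (e(n := a)) \<phi> = sat M (e'(n := a)) \<phi>" for a
    using All.prems by (intro All.IH) auto
  then show ?case by simp
qed simp

lemma finite_vars_trm: "finite (vars_trm t)"
  by (induction t) auto

lemma finite_free_vars: "finite (free_vars \<phi>)"
  by (induction \<phi>) (auto simp: finite_vars_trm)

lemma rename_trm:
  assumes "trm_in \<L> t"
  obtains t' where "trm_in \<L> t'" "vars_trm t' = \<sigma> ` vars_trm t"
    "\<And>M :: ('f, 'r, 'a) struct. \<And>e. trm_val M e t' = trm_val M (e \<circ> \<sigma>) t"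
proof -
  have "\<exists>t'. trm_in \<L> t' \<and> vars_trm t' = \<sigma> ` vars_trm t \<and>
      (\<forall>(M :: ('f, 'r, 'a) struct) e. trm_val M e t' = trm_val M (e \<circ> \<sigma>) t)"
    using assms
  proof (induction t)
    case (Var n)
    then show ?case by (intro exI[of _ "Var (\<sigma> n)"]) auto
  next
    case (App f ts)
    then have "\<forall>t\<in>set ts. \<exists>t'. trm_in \<L> t' \<and> vars_trm t' = \<sigma> ` vars_trm t \<and>
      (\<forall>(M :: ('f, 'r, 'a) struct) e. trm_val M e t' = trm_val M (e \<circ> \<sigma>) t)"
      by (simp add: list_all_iff o_def)
    then obtain F where F: "\<And>t. t \<in> set ts \<Longrightarrow> trm_in \<L> (F t) \<and> vars_trm (F t) = \<sigma> ` vars_trm t \<and>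
      (\<forall>(M :: ('f, 'r, 'a) struct) e. trm_val M e (F t) = trm_val M (e \<circ> \<sigma>) t)"
      by metis
    have "map (trm_val M e) (map F ts) = map (trm_val M (e \<circ> \<sigma>)) ts"
      for M :: "('f, 'r, 'a) struct" and e
      using F by auto
    then show ?case using F App.prems
      by (intro exI[of _ "App f (map F ts)"])
        (auto simp: list_all_iff image_Union o_def simp del: map_map)
  qed
  then show ?thesis using that by blast
qed

text \<open>The formula is only claimed to exist, because it depends on choices of fresh bound
  variables; later arguments use nothing but its meaning and the bound on its free variables. The
  map \<open>\<sigma>\<close> need not be injective: below it identifies variables that stand for
  equal elements.\<close>

lemma rename_fm:
  assumes "fm_in \<L> \<phi>"
  obtains \<psi> where "fm_in \<L> \<psi>" "free_vars \<psi> \<subseteq> \<sigma> ` free_vars \<phi>"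
    "\<And>M :: ('f, 'r, 'a) struct. \<And>e. sat M e \<psi> = sat M (e \<circ> \<sigma>) \<phi>"
proof -
  have "\<exists>\<psi>. fm_in \<L> \<psi> \<and> free_vars \<psi> \<subseteq> \<sigma> ` free_vars \<phi> \<and>
      (\<forall>(M :: ('f, 'r, 'a) struct) e. sat M e \<psi> = sat M (e \<circ> \<sigma>) \<phi>)"
    using assms
  proof (induction \<phi> arbitrary: \<sigma>)
    case Falsum
    then show ?case by (intro exI[of _ Falsum]) auto
  next
    case (Eq s t)
    then have "trm_in \<L> s" "trm_in \<L> t" by auto
    then obtain s' t' where "trm_in \<L> s'" "vars_trm s' = \<sigma> ` vars_trm s"
      "\<And>M :: ('f, 'r, 'a) struct. \<And>e. trm_val M e s' = trm_val M (e \<circ> \<sigma>) s"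
      "trm_in \<L> t'" "vars_trm t' = \<sigma> ` vars_trm t"
      "\<And>M :: ('f, 'r, 'a) struct. \<And>e. trm_val M e t' = trm_val M (e \<circ> \<sigma>) t"
      by (metis rename_trm)
    then show ?case by (intro exI[of _ "Eq s' t'"]) (auto simp: o_def)
  next
    case (Rel r ts)
    then have "\<forall>t\<in>set ts. \<exists>t'. trm_in \<L> t' \<and> vars_trm t' = \<sigma> ` vars_trm t \<and>
      (\<forall>(M :: ('f, 'r, 'a) struct) e. trm_val M e t' = trm_val M (e \<circ> \<sigma>) t)"
      by (metis fm_in.simps(3) list_all_iff rename_trm)
    then obtain F where F: "\<And>t. t \<in> set ts \<Longrightarrow> trm_in \<L> (F t) \<and> vars_trm (F t) = \<sigma> ` vars_trm t \<and>
      (\<forall>(M :: ('f, 'r, 'a) struct) e. trm_val M e (F t) = trm_val M (e \<circ> \<sigma>) t)"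
      by metis
    have "map (trm_val M e) (map F ts) = map (trm_val M (e \<circ> \<sigma>)) ts"
      for M :: "('f, 'r, 'a) struct" and e
      using F by auto
    then show ?case using F Rel.prems
      by (intro exI[of _ "Rel r (map F ts)"])
        (auto simp: list_all_iff image_Union o_def simp del: map_map)
  next
    case (Imp \<phi>1 \<phi>2)
    obtain \<psi>1 where \<psi>1: "fm_in \<L> \<psi>1" "free_vars \<psi>1 \<subseteq> \<sigma> ` free_vars \<phi>1"
      "\<forall>(M :: ('f, 'r, 'a) struct) e. sat M e \<psi>1 = sat M (e \<circ> \<sigma>) \<phi>1"
      using Imp.IH(1)[of \<sigma>] Imp.prems by (auto simp: o_def)
    obtain \<psi>2 where \<psi>2: "fm_in \<L> \<psi>2" "free_vars \<psi>2 \<subseteq> \<sigma> ` free_vars \<phi>2"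
      "\<forall>(M :: ('f, 'r, 'a) struct) e. sat M e \<psi>2 = sat M (e \<circ> \<sigma>) \<phi>2"
      using Imp.IH(2)[of \<sigma>] Imp.prems by (auto simp: o_def)
    show ?case using \<psi>1 \<psi>2 by (intro exI[of _ "Imp \<psi>1 \<psi>2"]) (auto simp: o_def)
  next
    case (All n \<phi>)
    \<comment> \<open>The bound variable is renamed to a fresh one, to avoid capture.\<close>
    obtain m where m: "m \<notin> \<sigma> ` free_vars \<phi>"
      using ex_new_if_finite[OF infinite_UNIV_nat] finite_free_vars by (metis finite_imageI)
    obtain \<psi> where \<psi>: "fm_in \<L> \<psi>" "free_vars \<psi> \<subseteq> (\<sigma>(n := m)) ` free_vars \<phi>"
      "\<forall>(M :: ('f, 'r, 'a) struct) e. sat M e \<psi> = sat M (e \<circ> \<sigma>(n := m)) \<phi>"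
      using All.IH[of "\<sigma>(n := m)"] All.prems by (metis fm_in.simps(5))
    have "sat M (e(m := a)) \<psi> = sat M ((e \<circ> \<sigma>)(n := a)) \<phi>" for M :: "('f, 'r, 'a) struct" and e a
    proof -
      have "sat M (e(m := a) \<circ> \<sigma>(n := m)) \<phi> = sat M ((e \<circ> \<sigma>)(n := a)) \<phi>"
        using m by (intro sat_cong) auto
      then show ?thesis using \<psi>(3) by simp
    qed
    moreover have "free_vars \<psi> - {m} \<subseteq> \<sigma> ` (free_vars \<phi> - {n})"
      using \<psi>(2) by (auto split: if_splits)
    ultimately show ?case using \<psi>(1) by (intro exI[of _ "All m \<psi>"]) (simp add: o_def)
  qed
  then show ?thesis using that by blast
qed

section \<open>Countability of the set of formulas\<close>

instance trm :: (countable) countable by countable_datatype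
instance fm :: (countable, countable) countable by countable_datatype

lemma set_trm_funs: "trm_in \<L> t \<Longrightarrow> set_trm t \<subseteq> funs \<L>"
  by (induction t) (auto simp: list_all_iff)

text \<open>The symbol types may be uncountable, so the type of all formulas may be too. A formula
  of the language contains only symbols of the language, hence renaming these by
  \<open>to_nat_on\<close> is injective on such formulas, with values in the countable type of
  formulas over \<open>nat\<close>.\<close>

lemma countable_fm_in:
  assumes "countable_language \<L>"
  shows "countable {\<phi>. fm_in \<L> \<phi>}"
proof -
  have s: "set1_fm \<phi> \<subseteq> funs \<L> \<and> set2_fm \<phi> \<subseteq> rels \<L>" if "fm_in \<L> \<phi>" for \<phi>
    using that
  proof (induction \<phi>)
    case (Eq s t)
    then show ?case using set_trm_funs[of \<L> s] set_trm_funs[of \<L> t] by auto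
  next
    case (Rel r ts)
    then show ?case using set_trm_funs[of \<L>] by (fastforce simp: list_all_iff)
  qed auto
  let ?f = "to_nat_on (funs \<L>)" and ?r = "to_nat_on (rels \<L>)"
  have i: "inj_on ?f (funs \<L>)" "inj_on ?r (rels \<L>)"
    using assms by (auto simp: countable_language_def inj_on_to_nat_on)
  have "inj_on (map_fm ?f ?r) {\<phi>. fm_in \<L> \<phi>}"
  proof (rule inj_onI)
    fix \<phi> \<psi> assume a: "\<phi> \<in> {\<phi>. fm_in \<L> \<phi>}" "\<psi> \<in> {\<phi>. fm_in \<L> \<phi>}" "map_fm ?f ?r \<phi> = map_fm ?f ?r \<psi>"
    then have "set1_fm \<phi> \<subseteq> funs \<L>" "set2_fm \<phi> \<subseteq> rels \<L>" "set1_fm \<psi> \<subseteq> funs \<L>" "set2_fm \<psi> \<subseteq> rels \<L>"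
      using s by auto
    then show "\<phi> = \<psi>"
      using fm.inj_map_strong[of \<phi> \<psi> ?f ?f ?r ?r] a(3) i unfolding inj_on_def by blast
  qed
  then show ?thesis by (rule countableI')
qed

section \<open>Transfer along isomorphisms and copies on the natural numbers\<close>

lemma isomorphism_trm_val:
  assumes M: "is_struct \<L> M" and h: "isomorphism \<L> M N h" and e: "range e \<subseteq> universe M"
    and t: "trm_in \<L> t"
  shows "trm_val M e t \<in> universe M \<and> trm_val N (h \<circ> e) t = h (trm_val M e t)"
  using t
proof (induction t)
  case (App f ts)
  then have ts: "\<And>t. t \<in> set ts \<Longrightarrow> trm_val M e t \<in> universe M \<and> trm_val N (h \<circ> e) t = h (trm_val M e t)"
    by (simp add: list_all_iff o_def)
  then have m: "map (trm_val N (h \<circ> e)) ts = map h (map (trm_val M e) ts)" by simp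
  have "map (trm_val M e) ts \<in> arguments M (farity \<L> f)"
    using ts App.prems by (auto simp: arguments_def)
  then show ?case using M h App.prems unfolding isomorphism_def is_struct_def
    by (simp only: trm_val.simps m trm_in.simps)
qed (use e in auto)

lemma isomorphism_sat:
  assumes M: "is_struct \<L> M" and h: "isomorphism \<L> M N h" and e: "range e \<subseteq> universe M"
    and \<phi>: "fm_in \<L> \<phi>"
  shows "sat N (h \<circ> e) \<phi> = sat M e \<phi>"
  using e \<phi>
proof (induction \<phi> arbitrary: e)
  case (Eq s t)
  have "inj_on h (universe M)" using h by (auto simp: isomorphism_def bij_betw_def)
  then show ?case using isomorphism_trm_val[OF M h Eq.prems(1)] Eq.prems(2) by (simp add: inj_on_eq_iff o_def)
next
  case (Rel r ts)
  then have ts: "\<And>t. t \<in> set ts \<Longrightarrow> trm_val M e t \<in> universe M \<and> trm_val N (h \<circ> e) t = h (trm_val M e t)"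
    using isomorphism_trm_val[OF M h] by (auto simp: list_all_iff)
  then have m: "map (trm_val N (h \<circ> e)) ts = map h (map (trm_val M e) ts)" by simp
  have "map (trm_val M e) ts \<in> arguments M (rarity \<L> r)"
    using ts Rel.prems by (auto simp: arguments_def)
  then show ?case using h Rel.prems unfolding isomorphism_def
    by (simp only: sat.simps m fm_in.simps)
next
  case (All n \<phi>)
  have "sat N ((h \<circ> e)(n := h a)) \<phi> = sat M (e(n := a)) \<phi>" if "a \<in> universe M" for a
  proof -
    have "(h \<circ> e)(n := h a) = h \<circ> e(n := a)" by auto
    moreover have "range (e(n := a)) \<subseteq> universe M" using that All.prems by auto
    ultimately show ?thesis using All.IH[of "e(n := a)"] All.prems by (metis fm_in.simps(5))
  qed
  moreover have "universe N = h ` universe M" using h by (auto simp: isomorphism_def bij_betw_def)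
  ultimately show ?case by (simp add: o_def)
qed auto

lemma isomorphism_comp:
  assumes "isomorphism \<L> M N h" "isomorphism \<L> N K k"
  shows "isomorphism \<L> M K (k \<circ> h)"
proof -
  have "map h xs \<in> arguments N n" if "xs \<in> arguments M n" for xs n
    using that assms(1) by (auto simp: arguments_def isomorphism_def bij_betw_def)
  moreover have "map (k \<circ> h) xs = map k (map h xs)" for xs by simp
  ultimately show ?thesis using assms unfolding isomorphism_def
    by (auto intro: bij_betw_trans simp del: map_map simp flip: map_map)
qed

lemma isomorphism_inv_into:
  assumes N: "is_struct \<L> N" and h: "isomorphism \<L> N K h"
  shows "isomorphism \<L> K N (inv_into (universe N) h)" (is "isomorphism \<L> K N ?k")
proof -
  have b: "bij_betw h (universe N) (universe K)" using h by (simp add: isomorphism_def)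
  have bk: "bij_betw ?k (universe K) (universe N)" using b by (rule bij_betw_inv_into)
  have kx: "map ?k xs \<in> arguments N n" and hk: "map h (map ?k xs) = xs"
    if "xs \<in> arguments K n" for xs n
    using that bij_betwE[OF bk] bij_betw_inv_into_right[OF b]
    by (auto simp: arguments_def subset_iff intro!: map_idI)
  show ?thesis unfolding isomorphism_def
  proof (intro conjI ballI bk)
    fix f xs assume f: "f \<in> funs \<L>" and xs: "xs \<in> arguments K (farity \<L> f)"
    have "interp_fun N f (map ?k xs) \<in> universe N"
      using N f kx[OF xs] by (auto simp: is_struct_def)
    moreover have "h (interp_fun N f (map ?k xs)) = interp_fun K f xs"
      using h f kx[OF xs] hk[OF xs] unfolding isomorphism_def by metis
    ultimately show "?k (interp_fun K f xs) = interp_fun N f (map ?k xs)"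
      using bij_betw_inv_into_left[OF b] by metis
  next
    fix r xs assume "r \<in> rels \<L>" and xs: "xs \<in> arguments K (rarity \<L> r)"
    then show "interp_rel K r xs = interp_rel N r (map ?k xs)"
      using h kx[OF xs] hk[OF xs] unfolding isomorphism_def by metis
  qed
qed

lemma countable_struct_nat_copy:
  assumes N: "is_struct \<L> N" "countable (universe N)"
  obtains K :: "('f, 'r, nat) struct" and h where "is_struct \<L> K" "isomorphism \<L> N K h"
proof -
  define h where "h = to_nat_on (universe N)"
  define k where "k = inv_into (universe N) h"
  define K where "K = \<lparr>universe = h ` universe N, interp_fun = (\<lambda>f xs. h (interp_fun N f (map k xs))),
    interp_rel = (\<lambda>r xs. interp_rel N r (map k xs))\<rparr>"
  have i: "inj_on h (universe N)" using N(2) by (simp add: h_def inj_on_to_nat_on)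
  then have kh: "map k (map h xs) = xs" if "xs \<in> arguments N n" for xs n
    using that by (auto simp: k_def arguments_def subset_iff intro!: map_idI)
  have kx: "map k xs \<in> arguments N n" if "xs \<in> arguments K n" for xs n
    using that inv_into_into[of _ h "universe N"] by (auto simp: arguments_def K_def k_def)
  have "is_struct \<L> K"
    unfolding is_struct_def using kx N(1) by (auto simp: K_def is_struct_def)
  moreover have "isomorphism \<L> N K h"
    unfolding isomorphism_def using i kh by (auto simp: K_def bij_betw_def simp del: map_map)
  ultimately show ?thesis using that by blast
qed

text \<open>The definition of categoricity quantifies over models on \<open>nat\<close> only. The
  models constructed below consist of sequences or lie inside \<open>M\<close>; a copy on
  \<open>nat\<close> makes categoricity applicable to them.\<close>

lemma omega_categorical_isomorphic:
  fixes \<L> :: "('f, 'r) language"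
  assumes M: "omega_categorical \<L> M" and N: "is_struct \<L> N" "countable (universe N)"
    and th: "\<And>\<phi>. \<phi> \<in> theory_of \<L> M \<Longrightarrow> models N \<phi>"
  shows "isomorphic \<L> M N"
proof -
  obtain K :: "('f, 'r, nat) struct" and h where K: "is_struct \<L> K" and h: "isomorphism \<L> N K h"
    using countable_struct_nat_copy[OF N] .
  have "models K \<phi>" if \<phi>: "\<phi> \<in> theory_of \<L> M" for \<phi>
    unfolding models_def
  proof (intro allI impI)
    fix e :: "nat \<Rightarrow> nat" assume e: "range e \<subseteq> universe K"
    have "range (inv_into (universe N) h \<circ> e) \<subseteq> universe N"
      using isomorphism_inv_into[OF N(1) h] e by (auto simp: isomorphism_def bij_betw_def)
    then have "sat N (inv_into (universe N) h \<circ> e) \<phi>"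
      using th[OF \<phi>] by (simp add: models_def)
    then show "sat K e \<phi>"
      using isomorphism_sat[OF K isomorphism_inv_into[OF N(1) h] e] \<phi> by (simp add: theory_of_def)
  qed
  then obtain g where "isomorphism \<L> M K g"
    using M K by (auto simp: omega_categorical_def isomorphic_def)
  then have "isomorphism \<L> M N (inv_into (universe N) h \<circ> g)"
    using isomorphism_comp isomorphism_inv_into[OF N(1) h] by blast
  then show ?thesis by (auto simp: isomorphic_def)
qed

section \<open>Realising countable sets of formulas\<close>

text \<open>Zorn's lemma for the reversed order gives a minimal proper filter below
  \<open>F\<close>. It decides every predicate: if \<open>P\<close> does not hold eventually, adding
  the complement of \<open>P\<close> leaves the filter proper, so by minimality the complement
  already belonged to it.\<close>

lemma ultrafilter_exists:
  assumes "F \<noteq> bot"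
  obtains U :: "'a filter" where "U \<le> F" "U \<noteq> bot"
    "\<And>P. \<not> eventually P U \<Longrightarrow> eventually (\<lambda>x. \<not> P x) U"
proof -
  let ?A = "{U. U \<le> F \<and> U \<noteq> bot}"
  have "\<exists>U\<in>?A. \<forall>V\<in>?A. U \<ge> V \<longrightarrow> V = U"
  proof (rule predicate_Zorn)
    show "partial_order_on ?A (relation_of (\<ge>) ?A)"
      by (rule partial_order_on_relation_ofI) auto
    fix C assume C: "C \<in> Chains (relation_of (\<ge>) ?A)"
    show "\<exists>u\<in>?A. \<forall>a\<in>C. a \<ge> u"
    proof (cases "C = {}")
      case True
      then show ?thesis using assms by auto
    next
      case False
      have sub: "C \<subseteq> ?A" using C by (auto simp: Chains_def relation_of_def)
      have ch: "G \<le> H \<or> H \<le> G" if "G \<in> C" "H \<in> C" for G H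
        using C that by (auto simp: Chains_def relation_of_def)
      \<comment> \<open>In a chain, whatever holds eventually for the infimum already does so for
        one of the members. For the false predicate this says that the infimum is proper.\<close>
      have "eventually P (Inf C) \<longleftrightarrow> (\<exists>b\<in>C. eventually P b)" for P
      proof (rule eventually_Inf_base[OF False])
        fix G H assume "G \<in> C" "H \<in> C"
        then show "\<exists>x\<in>C. x \<le> inf G H" using ch[of G H] by (metis inf.absorb1 inf.absorb2 order_refl)
      qed
      from this[of "\<lambda>_. False"] have "Inf C \<noteq> bot"
        using sub by (auto simp: trivial_limit_def)
      moreover have "Inf C \<le> F"
      proof -
        obtain G where "G \<in> C" using False by blast
        then have "Inf C \<le> G" "G \<le> F" using sub by (auto intro: Inf_lower)
        then show ?thesis by (rule order_trans)
      qed
      ultimately show ?thesis by (intro bexI[of _ "Inf C"]) (auto intro: Inf_lower)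
    qed
  qed
  then obtain U where U: "U \<le> F" "U \<noteq> bot" "\<And>V. V \<le> F \<Longrightarrow> V \<noteq> bot \<Longrightarrow> V \<le> U \<Longrightarrow> V = U"
    by auto
  have "eventually (\<lambda>x. \<not> P x) U" if "\<not> eventually P U" for P
  proof -
    let ?V = "inf U (principal {x. \<not> P x})"
    have "?V \<noteq> bot" using that by (auto simp: trivial_limit_def eventually_inf_principal)
    then have "?V = U" using U(1) by (intro U(3)) (auto intro: le_infI1)
    moreover have "eventually (\<lambda>x. \<not> P x) ?V" by (simp add: eventually_inf_principal)
    ultimately show ?thesis by metis
  qed
  then show ?thesis using that U by blast
qed

text \<open>The closure is reached after countably many stages, since a finite list already lies in
  one of them. The upper bound on \<open>S\<close> matters as well: a property shared by
  \<open>X\<close> and all values of \<open>f\<close>, here that of being a sequence in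
  \<open>M\<close>, passes to \<open>S\<close>.\<close>

lemma countable_closure:
  fixes f :: "'b \<Rightarrow> 'c list \<Rightarrow> 'c"
  assumes "countable B" "countable X"
  shows "\<exists>S. X \<subseteq> S \<and> countable S \<and> S \<subseteq> X \<union> {f b xs |b xs. True} \<and>
    (\<forall>b\<in>B. \<forall>xs. set xs \<subseteq> S \<longrightarrow> f b xs \<in> S)"
proof -
  define T where "T = rec_nat X (\<lambda>_ S. S \<union> (\<lambda>(b, xs). f b xs) ` (B \<times> lists S))"
  have T: "T 0 = X" "\<And>m. T (Suc m) = T m \<union> (\<lambda>(b, xs). f b xs) ` (B \<times> lists (T m))"
    by (simp_all add: T_def)
  have mono: "T m \<subseteq> T m'" if "m \<le> m'" for m m'
    using that by (rule lift_Suc_mono_le[rotated]) (auto simp: T)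
  have "countable (T m)" for m
    by (induction m) (auto simp: T assms)
  moreover have "T m \<subseteq> X \<union> {f b xs |b xs. True}" for m
    by (induction m) (auto simp: T)
  moreover have "f b xs \<in> (\<Union>m. T m)" if b: "b \<in> B" and xs: "set xs \<subseteq> (\<Union>m. T m)" for b xs
  proof -
    have "\<exists>m. set xs \<subseteq> T m"
      using xs
    proof (induction xs)
      case (Cons x xs)
      then obtain m m' where "x \<in> T m" "set xs \<subseteq> T m'" by auto
      then have "set (x # xs) \<subseteq> T (max m m')"
        using mono[of m "max m m'"] mono[of m' "max m m'"] by auto
      then show ?case by blast
    qed simp
    then obtain m where "set xs \<subseteq> T m" ..
    then have "f b xs \<in> T (Suc m)" using b by (auto simp: T in_lists_conv_set)
    then show ?thesis by blast
  qed
  moreover have "X \<subseteq> (\<Union>m. T m)" using T(1) by auto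
  ultimately show ?thesis by (intro exI[of _ "\<Union>m. T m"] conjI) (simp_all add: UN_least)
qed

text \<open>An ultrapower of \<open>M\<close>, restricted to a countable set of sequences closed under Skolem
  functions, realises a given finitely satisfiable sequence of formulas.\<close>

lemma countable_compactness:
  fixes M :: "('f, 'r, 'a) struct" and \<Phi> :: "nat \<Rightarrow> ('f, 'r) fm"
  assumes L: "countable_language \<L>" and M: "is_struct \<L> M"
    and \<Phi>: "\<And>k. fm_in \<L> (\<Phi> k)"
    and fs: "\<And>k. \<exists>e. range e \<subseteq> universe M \<and> (\<forall>i\<le>k. sat M e (\<Phi> i))"
  obtains N :: "('f, 'r, nat \<Rightarrow> 'a) struct" and e where "is_struct \<L> N" "countable (universe N)"
    "\<And>\<phi>. \<phi> \<in> theory_of \<L> M \<Longrightarrow> models N \<phi>" "range e \<subseteq> universe N" "\<And>i. sat N e (\<Phi> i)"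
proof -
  \<comment> \<open>\<open>E k\<close> satisfies the formulas up to index \<open>k\<close>. Read
    along the other argument, \<open>\<lambda>k. E k i\<close> is the sequence that will be assigned
    to variable \<open>i\<close>.\<close>
  obtain E where E: "\<And>k. range (E k) \<subseteq> universe M" "\<And>k i. i \<le> k \<Longrightarrow> sat M (E k) (\<Phi> i)"
    using fs by metis
  obtain d where d: "d \<in> universe M" using M by (auto simp: is_struct_def)
  \<comment> \<open>Refining \<open>sequentially\<close> makes every tail large. Since
    \<open>\<Phi> j\<close> holds under \<open>E k\<close> for all \<open>k \<ge> j\<close>, it will
    hold in the ultrapower.\<close>
  obtain U :: "nat filter" where U: "U \<le> sequentially" "U \<noteq> bot"
    "\<And>P. \<not> eventually P U \<Longrightarrow> eventually (\<lambda>x. \<not> P x) U"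
    using ultrafilter_exists[of sequentially] by auto
  \<comment> \<open>Closing a countable set under Skolem functions requires finite lists of
    arguments. An assignment is therefore cut to a list and padded by \<open>d\<close>, which is
    harmless beyond the free variables of a formula.\<close>
  define as where "as gs k i = (if i < length gs then (gs ! i) k else d)"
    for gs :: "(nat \<Rightarrow> 'a) list" and k i
  define sk where "sk = (\<lambda>(\<phi>, n) gs k.
    if \<exists>a\<in>universe M. sat M ((as gs k)(n := a)) \<phi>
    then SOME a. a \<in> universe M \<and> sat M ((as gs k)(n := a)) \<phi> else d)"
  have sk: "sk (\<phi>, n) gs k \<in> universe M \<and>
      ((\<exists>a\<in>universe M. sat M ((as gs k)(n := a)) \<phi>) \<longrightarrow> sat M ((as gs k)(n := sk (\<phi>, n) gs k)) \<phi>)"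
    for \<phi> n gs k
    unfolding sk_def using someI_ex[of "\<lambda>a. a \<in> universe M \<and> sat M ((as gs k)(n := a)) \<phi>"] d by auto
  have "countable ({\<phi>. fm_in \<L> \<phi>} \<times> (UNIV :: nat set))"
    using countable_fm_in[OF L] by blast
  moreover have "countable (range (\<lambda>i k. E k i))" by simp
  ultimately have "\<exists>S. range (\<lambda>i k. E k i) \<subseteq> S \<and> countable S \<and>
      S \<subseteq> range (\<lambda>i k. E k i) \<union> {sk b xs |b xs. True} \<and>
      (\<forall>b\<in>{\<phi>. fm_in \<L> \<phi>} \<times> UNIV. \<forall>xs. set xs \<subseteq> S \<longrightarrow> sk b xs \<in> S)"
    by (rule countable_closure)
  then obtain S where S: "range (\<lambda>i k. E k i) \<subseteq> S" "countable S"
      "S \<subseteq> range (\<lambda>i k. E k i) \<union> {sk b xs |b xs. True}"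
      "\<forall>b\<in>{\<phi>. fm_in \<L> \<phi>} \<times> UNIV. \<forall>xs. set xs \<subseteq> S \<longrightarrow> sk b xs \<in> S"
    by (elim exE conjE) (rule that)
  have SM: "g k \<in> universe M" if "g \<in> S" for g k
  proof -
    have "g \<in> range (\<lambda>i k. E k i) \<union> {sk b xs |b xs. True}" using S(3) that by (rule subsetD)
    then show ?thesis
    proof (elim UnE rangeE CollectE exE conjE)
      fix i assume "g = (\<lambda>k. E k i)"
      then show ?thesis using E(1)[of k] by auto
    next
      fix b gs assume "g = sk b gs"
      then show ?thesis using sk[of "fst b" "snd b"] by simp
    qed
  qed
  \<comment> \<open>A single sequence in \<open>S\<close> provides witnesses at all coordinates at
    once. This is what keeps the quantifier step of Los's theorem true although \<open>S\<close> is
    only a countable part of the power.\<close>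
  have skolem: "\<exists>g\<in>S. \<forall>k. (\<exists>a\<in>universe M. sat M ((\<lambda>i. e i k)(n := a)) \<phi>)
      \<longrightarrow> sat M ((\<lambda>i. e i k)(n := g k)) \<phi>"
    if e: "range e \<subseteq> S" and \<phi>: "fm_in \<L> \<phi>" for e n \<phi>
  proof -
    obtain m where m: "\<And>i. i \<in> free_vars \<phi> \<Longrightarrow> i < m"
      using finite_free_vars[of \<phi>] by (meson finite_nat_set_iff_bounded)
    let ?gs = "map e [0..<m]"
    have eq: "sat M ((as ?gs k)(n := a)) \<phi> = sat M ((\<lambda>i. e i k)(n := a)) \<phi>" for k a
      using m by (intro sat_cong) (auto simp: as_def)
    have "sk (\<phi>, n) ?gs \<in> S" using e \<phi> by (intro S(4)[rule_format]) auto
    then show ?thesis using sk[of \<phi> n ?gs] unfolding eq by blast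
  qed
  \<comment> \<open>Closure under the functions of the language comes for free: the only witness for
    \<open>x\<close> in \<open>f(g_0, ..., g_(n-1)) = x\<close> is the value of
    \<open>f\<close>.\<close>
  have fun_closed: "(\<lambda>k. interp_fun M f (map (\<lambda>g. g k) gs)) \<in> S"
    if f: "f \<in> funs \<L>" and gs: "set gs \<subseteq> S" "length gs = farity \<L> f" for f gs
  proof -
    let ?n = "length gs"
    let ?e = "\<lambda>i. if i < ?n then gs ! i else (\<lambda>k. E k 0)"
    let ?\<phi> = "Eq (App f (map Var [0..<?n])) (Var ?n)"
    have v: "map (\<lambda>i. if i = ?n then a else ?e i k) [0..<?n] = map (\<lambda>g. g k) gs" for a k
      by (rule nth_equalityI) auto
    have "range ?e \<subseteq> S" using gs(1) S(1) by auto
    moreover have "fm_in \<L> ?\<phi>" using f gs(2) by (simp add: list_all_iff)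
    ultimately obtain g where g: "g \<in> S" "\<And>k. (\<exists>a\<in>universe M. sat M ((\<lambda>i. ?e i k)(?n := a)) ?\<phi>)
      \<longrightarrow> sat M ((\<lambda>i. ?e i k)(?n := g k)) ?\<phi>"
      using skolem by blast
    have "interp_fun M f (map (\<lambda>g. g k) gs) = g k" for k
    proof -
      have "map (\<lambda>g. g k) gs \<in> arguments M (farity \<L> f)"
        using gs SM by (auto simp: arguments_def)
      then have "interp_fun M f (map (\<lambda>g. g k) gs) \<in> universe M"
        using M f by (auto simp: is_struct_def)
      then show ?thesis using g(2)[of k] v by (simp add: fun_upd_def o_def)
    qed
    then show ?thesis using g(1) by simp
  qed
  \<comment> \<open>Each class of sequences modulo \<open>U\<close> is replaced by one chosen
    member, so that the elements of \<open>N\<close> are again sequences.\<close>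
  define rep where "rep g = (SOME h. h \<in> S \<and> (\<forall>\<^sub>F k in U. g k = h k))" for g
  have rep: "rep g \<in> S" "\<forall>\<^sub>F k in U. g k = rep g k" if "g \<in> S" for g
    using someI[of "\<lambda>h. h \<in> S \<and> (\<forall>\<^sub>F k in U. g k = h k)" g] that by (simp_all add: rep_def)
  have rep_eq: "rep g = rep h" if "\<forall>\<^sub>F k in U. g k = h k" for g h
  proof -
    have "(\<forall>\<^sub>F k in U. g k = x k) \<longleftrightarrow> (\<forall>\<^sub>F k in U. h k = x k)" for x
      by (rule eventually_cong[OF that]) simp
    then show ?thesis by (simp add: rep_def)
  qed
  define N where "N = \<lparr>universe = rep ` S,
    interp_fun = (\<lambda>f gs. rep (\<lambda>k. interp_fun M f (map (\<lambda>g. g k) gs))),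
    interp_rel = (\<lambda>r gs. \<forall>\<^sub>F k in U. interp_rel M r (map (\<lambda>g. g k) gs))\<rparr>"
  have N: "is_struct \<L> N"
    unfolding is_struct_def
  proof (intro conjI ballI)
    show "universe N \<noteq> {}" using S(1) by (auto simp: N_def)
    fix f xs assume "f \<in> funs \<L>" "xs \<in> arguments N (farity \<L> f)"
    moreover from this have "set xs \<subseteq> S" using rep(1) by (auto simp: N_def arguments_def)
    ultimately show "interp_fun N f xs \<in> universe N"
      using fun_closed[of f xs] by (auto simp: N_def arguments_def)
  qed
  have map_rep: "\<forall>\<^sub>F k in U. map (\<lambda>g. g k) (map rep gs) = map (\<lambda>g. g k) gs"
    if "set gs \<subseteq> S" for gs
  proof -
    have "\<forall>\<^sub>F k in U. \<forall>g\<in>set gs. g k = rep g k"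
      using that rep(2) by (intro eventually_ball_finite) auto
    then show ?thesis by eventually_elim auto
  qed
  have val: "(\<lambda>k. trm_val M (\<lambda>i. e i k) t) \<in> S \<and>
      trm_val N (\<lambda>i. rep (e i)) t = rep (\<lambda>k. trm_val M (\<lambda>i. e i k) t)"
    if e: "range e \<subseteq> S" and t: "trm_in \<L> t" for e t
    using t
  proof (induction t)
    case (Var n)
    then show ?case using e by auto
  next
    case (App f ts)
    let ?gs = "map (\<lambda>t k. trm_val M (\<lambda>i. e i k) t) ts"
    have gs: "set ?gs \<subseteq> S" "map (trm_val N (\<lambda>i. rep (e i))) ts = map rep ?gs"
      using App by (auto simp: list_all_iff)
    have "rep (\<lambda>k. interp_fun M f (map (\<lambda>g. g k) (map rep ?gs))) =
        rep (\<lambda>k. interp_fun M f (map (\<lambda>g. g k) ?gs))"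
      by (rule rep_eq) (use map_rep[OF gs(1)] in eventually_elim, rule arg_cong)
    then have "trm_val N (\<lambda>i. rep (e i)) (App f ts) = rep (\<lambda>k. trm_val M (\<lambda>i. e i k) (App f ts))"
      unfolding trm_val.simps gs(2) by (simp add: N_def o_def)
    then show ?case using fun_closed[of f ?gs] gs(1) App.prems by (simp add: o_def)
  qed
  \<comment> \<open>Los's theorem. Implication uses that \<open>U\<close> decides every predicate.
    For the quantifier, a Skolem sequence for the negated formula turns validity for all sequences
    in \<open>S\<close> into validity for all elements of \<open>M\<close> at almost every
    coordinate.\<close>
  have los: "sat N (\<lambda>i. rep (e i)) \<phi> \<longleftrightarrow> (\<forall>\<^sub>F k in U. sat M (\<lambda>i. e i k) \<phi>)"
    if "range e \<subseteq> S" "fm_in \<L> \<phi>" for e \<phi>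
    using that
  proof (induction \<phi> arbitrary: e)
    case Falsum
    then show ?case using U(2) by (simp add: trivial_limit_def)
  next
    case (Eq s t)
    then have v: "(\<lambda>k. trm_val M (\<lambda>i. e i k) s) \<in> S" "(\<lambda>k. trm_val M (\<lambda>i. e i k) t) \<in> S"
      "trm_val N (\<lambda>i. rep (e i)) s = rep (\<lambda>k. trm_val M (\<lambda>i. e i k) s)"
      "trm_val N (\<lambda>i. rep (e i)) t = rep (\<lambda>k. trm_val M (\<lambda>i. e i k) t)"
      using val by auto
    have "rep g = rep h \<longleftrightarrow> (\<forall>\<^sub>F k in U. g k = h k)" if "g \<in> S" "h \<in> S" for g h
    proof
      assume eq: "rep g = rep h"
      show "\<forall>\<^sub>F k in U. g k = h k" using rep(2)[OF that(1)] rep(2)[OF that(2)]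
        by eventually_elim (simp add: eq)
    qed (rule rep_eq)
    then show ?case using v by simp
  next
    case (Rel r ts)
    let ?gs = "map (\<lambda>t k. trm_val M (\<lambda>i. e i k) t) ts"
    have gs: "set ?gs \<subseteq> S" "map (trm_val N (\<lambda>i. rep (e i))) ts = map rep ?gs"
      using Rel val by (auto simp: list_all_iff)
    have "(\<forall>\<^sub>F k in U. interp_rel M r (map (\<lambda>g. g k) (map rep ?gs))) \<longleftrightarrow>
        (\<forall>\<^sub>F k in U. interp_rel M r (map (\<lambda>g. g k) ?gs))"
      by (rule eventually_cong, rule map_rep[OF gs(1)]) (rule arg_cong)
    then show ?case unfolding sat.simps gs(2) by (simp add: N_def o_def)
  next
    case (Imp \<phi> \<psi>)
    then have "sat N (\<lambda>i. rep (e i)) (Imp \<phi> \<psi>) \<longleftrightarrow>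
      ((\<forall>\<^sub>F k in U. sat M (\<lambda>i. e i k) \<phi>) \<longrightarrow> (\<forall>\<^sub>F k in U. sat M (\<lambda>i. e i k) \<psi>))" by simp
    also have "\<dots> \<longleftrightarrow> (\<forall>\<^sub>F k in U. sat M (\<lambda>i. e i k) \<phi> \<longrightarrow> sat M (\<lambda>i. e i k) \<psi>)"
    proof (intro iffI impI)
      assume *: "(\<forall>\<^sub>F k in U. sat M (\<lambda>i. e i k) \<phi>) \<longrightarrow> (\<forall>\<^sub>F k in U. sat M (\<lambda>i. e i k) \<psi>)"
      then consider "\<forall>\<^sub>F k in U. \<not> sat M (\<lambda>i. e i k) \<phi>" | "\<forall>\<^sub>F k in U. sat M (\<lambda>i. e i k) \<psi>"
        using U(3)[of "\<lambda>k. sat M (\<lambda>i. e i k) \<phi>"] by blast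
      then show "\<forall>\<^sub>F k in U. sat M (\<lambda>i. e i k) \<phi> \<longrightarrow> sat M (\<lambda>i. e i k) \<psi>"
        by cases (auto elim: eventually_mono)
    qed (rule eventually_mp)
    finally show ?case by simp
  next
    case (All n \<phi>)
    have IH: "sat N ((\<lambda>i. rep (e i))(n := rep g)) \<phi> \<longleftrightarrow>
        (\<forall>\<^sub>F k in U. sat M ((\<lambda>i. e i k)(n := g k)) \<phi>)" if "g \<in> S" for g
    proof -
      have "(\<lambda>i. rep (e i))(n := rep g) = (\<lambda>i. rep ((e(n := g)) i))"
        "\<And>k. (\<lambda>i. e i k)(n := g k) = (\<lambda>i. (e(n := g)) i k)" by auto
      moreover have "range (e(n := g)) \<subseteq> S" "fm_in \<L> \<phi>" using that All.prems by auto
      ultimately show ?thesis using All.IH[of "e(n := g)"] by simp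
    qed
    have "(\<forall>g\<in>S. \<forall>\<^sub>F k in U. sat M ((\<lambda>i. e i k)(n := g k)) \<phi>) \<longleftrightarrow>
      (\<forall>\<^sub>F k in U. \<forall>a\<in>universe M. sat M ((\<lambda>i. e i k)(n := a)) \<phi>)"
    proof
      assume *: "\<forall>g\<in>S. \<forall>\<^sub>F k in U. sat M ((\<lambda>i. e i k)(n := g k)) \<phi>"
      obtain g where "g \<in> S" "\<forall>k. (\<exists>a\<in>universe M. sat M ((\<lambda>i. e i k)(n := a)) (fm_neg \<phi>))
        \<longrightarrow> sat M ((\<lambda>i. e i k)(n := g k)) (fm_neg \<phi>)"
        using skolem[of e "fm_neg \<phi>" n] All.prems by auto
      then show "\<forall>\<^sub>F k in U. \<forall>a\<in>universe M. sat M ((\<lambda>i. e i k)(n := a)) \<phi>"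
        using * by (force elim: eventually_mono)
    next
      assume *: "\<forall>\<^sub>F k in U. \<forall>a\<in>universe M. sat M ((\<lambda>i. e i k)(n := a)) \<phi>"
      show "\<forall>g\<in>S. \<forall>\<^sub>F k in U. sat M ((\<lambda>i. e i k)(n := g k)) \<phi>"
        using SM by (auto intro: eventually_mono[OF *])
    qed
    then show ?case using IH by (simp add: N_def)
  qed
  have "models N \<phi>" if \<phi>: "\<phi> \<in> theory_of \<L> M" for \<phi>
    unfolding models_def
  proof (intro allI impI)
    fix e' :: "nat \<Rightarrow> nat \<Rightarrow> 'a" assume "range e' \<subseteq> universe N"
    then have "\<forall>i. \<exists>g\<in>S. e' i = rep g" by (auto simp: N_def)
    then obtain e where e: "\<And>i. e i \<in> S" "\<And>i. e' i = rep (e i)" by metis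
    have "sat M (\<lambda>i. e i k) \<phi>" for k
    proof -
      have "range (\<lambda>i. e i k) \<subseteq> universe M" using e(1) SM by auto
      then show ?thesis using \<phi> by (simp add: theory_of_def models_def)
    qed
    then have "sat N (\<lambda>i. rep (e i)) \<phi>" using los[of e \<phi>] e(1) \<phi> by (auto simp: theory_of_def)
    then show "sat N e' \<phi>" using e(2) by presburger
  qed
  moreover have "sat N (\<lambda>i. rep (\<lambda>k. E k i)) (\<Phi> j)" for j
  proof -
    have "\<forall>\<^sub>F k in U. j \<le> k"
      using U(1) eventually_ge_at_top[of j] by (auto simp: le_filter_def)
    then have "\<forall>\<^sub>F k in U. sat M (E k) (\<Phi> j)" by eventually_elim (rule E(2))
    then show ?thesis using los[of "\<lambda>i k. E k i" "\<Phi> j"] S(1) \<Phi> by simp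
  qed
  moreover have "countable (universe N)" using S(2) by (simp add: N_def)
  moreover have "range (\<lambda>i. rep (\<lambda>k. E k i)) \<subseteq> universe N" using S(1) by (auto simp: N_def)
  ultimately show ?thesis using that N by blast
qed

section \<open>Countably categorical structures\<close>

lemma sat_conj_list: "sat M e (foldr fm_conj \<phi>s \<psi>) \<longleftrightarrow> (\<forall>\<phi>\<in>set \<phi>s. sat M e \<phi>) \<and> sat M e \<psi>"
  by (induction \<phi>s) auto

lemma sat_ex_list:
  assumes "range e \<subseteq> universe M"
  shows "sat M e (foldr fm_ex xs \<phi>) \<longleftrightarrow>
    (\<exists>e'. range e' \<subseteq> universe M \<and> (\<forall>i. i \<notin> set xs \<longrightarrow> e' i = e i) \<and> sat M e' \<phi>)"
  using assms
proof (induction xs arbitrary: e)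
  case Nil
  have "e' = e" if "\<forall>i. e' i = e i" for e' using that by auto
  then show ?case using Nil by auto
next
  case (Cons x xs)
  have "sat M e (foldr fm_ex (x # xs) \<phi>) \<longleftrightarrow> (\<exists>c\<in>universe M. sat M (e(x := c)) (foldr fm_ex xs \<phi>))"
    by simp
  also have "\<dots> \<longleftrightarrow> (\<exists>c\<in>universe M. \<exists>e'. range e' \<subseteq> universe M \<and>
      (\<forall>i. i \<notin> set xs \<longrightarrow> e' i = (e(x := c)) i) \<and> sat M e' \<phi>)"
    using Cons.prems by (intro bex_cong refl Cons.IH) auto
  also have "\<dots> \<longleftrightarrow> (\<exists>e'. range e' \<subseteq> universe M \<and>
      (\<forall>i. i \<notin> set (x # xs) \<longrightarrow> e' i = e i) \<and> sat M e' \<phi>)"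
  proof
    assume "\<exists>e'. range e' \<subseteq> universe M \<and> (\<forall>i. i \<notin> set (x # xs) \<longrightarrow> e' i = e i) \<and> sat M e' \<phi>"
    then obtain e' where "range e' \<subseteq> universe M" "\<forall>i. i \<notin> set (x # xs) \<longrightarrow> e' i = e i" "sat M e' \<phi>"
      by blast
    then show "\<exists>c\<in>universe M. \<exists>e'. range e' \<subseteq> universe M \<and>
      (\<forall>i. i \<notin> set xs \<longrightarrow> e' i = (e(x := c)) i) \<and> sat M e' \<phi>"
      by (intro bexI[of _ "e' x"] exI[of _ e']) auto
  next
    assume "\<exists>c\<in>universe M. \<exists>e'. range e' \<subseteq> universe M \<and>
      (\<forall>i. i \<notin> set xs \<longrightarrow> e' i = (e(x := c)) i) \<and> sat M e' \<phi>"
    then obtain c e' where "range e' \<subseteq> universe M"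
      "\<forall>i. i \<notin> set xs \<longrightarrow> e' i = (e(x := c)) i" "sat M e' \<phi>"
      by blast
    then show "\<exists>e'. range e' \<subseteq> universe M \<and> (\<forall>i. i \<notin> set (x # xs) \<longrightarrow> e' i = e i) \<and> sat M e' \<phi>"
      by (intro exI[of _ e']) auto
  qed
  finally show ?case .
qed

lemma fm_in_foldr_ex: "fm_in \<L> (foldr fm_ex xs \<phi>) \<longleftrightarrow> fm_in \<L> \<phi>"
  by (induction xs) auto

lemma free_vars_foldr_ex: "free_vars (foldr fm_ex xs \<phi>) = free_vars \<phi> - set xs"
  by (induction xs) auto

lemma fm_in_foldr_conj: "fm_in \<L> (foldr fm_conj \<phi>s \<psi>) \<longleftrightarrow> (\<forall>\<phi>\<in>set \<phi>s. fm_in \<L> \<phi>) \<and> fm_in \<L> \<psi>"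
  by (induction \<phi>s) auto

lemma free_vars_foldr_conj:
  "free_vars (foldr fm_conj \<phi>s \<psi>) = (\<Union>\<phi>\<in>set \<phi>s. free_vars \<phi>) \<union> free_vars \<psi>"
  by (induction \<phi>s) auto

section \<open>Complete formulas and isolated types in a categorical structure\<close>

locale omega_categorical_struct =
  fixes \<L> :: "('f, 'r) language" and M :: "('f, 'r, 'a) struct"
  assumes language: "countable_language \<L>"
    and struct: "is_struct \<L> M"
    and categorical: "omega_categorical \<L> M"
begin

definition env :: "(nat \<Rightarrow> 'a) \<Rightarrow> bool"
  where "env e \<longleftrightarrow> range e \<subseteq> universe M"

definition Fm :: "nat \<Rightarrow> ('f, 'r) fm set"
  where "Fm n = {\<phi>. fm_in \<L> \<phi> \<and> free_vars \<phi> \<subseteq> {..<n}}"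

text \<open>An \<open>n\<close>-tuple is represented by the values of an assignment at the variables below \<open>n\<close>.\<close>

definition complete :: "nat \<Rightarrow> ('f, 'r) fm \<Rightarrow> bool"
  where "complete n \<theta> \<longleftrightarrow> \<theta> \<in> Fm n \<and> (\<exists>e. env e \<and> sat M e \<theta>) \<and>
    (\<forall>\<psi>\<in>Fm n. \<forall>e e'. env e \<and> env e' \<and> sat M e \<theta> \<and> sat M e' \<theta> \<longrightarrow> sat M e \<psi> = sat M e' \<psi>)"

definition isolated :: "nat \<Rightarrow> (nat \<Rightarrow> 'a) \<Rightarrow> bool"
  where "isolated n e \<longleftrightarrow> (\<exists>\<theta>. complete n \<theta> \<and> sat M e \<theta>)"

lemma env_in: "env e \<Longrightarrow> e i \<in> universe M"
  by (auto simp: env_def)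

lemma env_upd: "env e \<Longrightarrow> c \<in> universe M \<Longrightarrow> env (e(n := c))"
  by (auto simp: env_def)

lemma sat_Fm_cong: "\<phi> \<in> Fm n \<Longrightarrow> (\<And>i. i < n \<Longrightarrow> e i = e' i) \<Longrightarrow> sat M e \<phi> = sat M e' \<phi>"
  by (intro sat_cong) (auto simp: Fm_def)

lemma complete_Fm: "complete n \<theta> \<Longrightarrow> \<theta> \<in> Fm n"
  unfolding complete_def by blast

lemma completeD:
  assumes "complete n \<theta>" "\<psi> \<in> Fm n" "env e" "env e'" "sat M e \<theta>" "sat M e' \<theta>" "sat M e \<psi>"
  shows "sat M e' \<psi>"
  using assms unfolding complete_def by blast

lemma isolated_cong:
  assumes "isolated n e" "\<And>i. i < n \<Longrightarrow> e i = e' i"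
  shows "isolated n e'"
proof -
  obtain \<theta> where \<theta>: "complete n \<theta>" "sat M e \<theta>" using assms(1) by (auto simp: isolated_def)
  then have "sat M e \<theta> = sat M e' \<theta>"
    using assms(2) by (intro sat_Fm_cong[of _ n]) (simp_all add: complete_Fm)
  then show ?thesis using \<theta> by (auto simp: isolated_def)
qed

lemma countable_universe: "countable (universe M)"
  using categorical by (simp add: omega_categorical_def)

text \<open>Compactness yields some countable model of the theory realising all formulas; by
  categoricity it is isomorphic to \<open>M\<close>, and the assignment is carried back. This is the
  only way in which compactness is used from here on.\<close>

lemma realize:
  fixes \<Phi> :: "nat \<Rightarrow> ('f, 'r) fm"
  assumes "\<And>k. fm_in \<L> (\<Phi> k)" and "\<And>k. \<exists>e. env e \<and> (\<forall>i\<le>k. sat M e (\<Phi> i))"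
  shows "\<exists>e. env e \<and> (\<forall>i. sat M e (\<Phi> i))"
proof -
  have fs: "\<exists>e. range e \<subseteq> universe M \<and> (\<forall>i\<le>k. sat M e (\<Phi> i))" for k
    using assms(2)[of k] by (simp only: env_def)
  obtain N :: "('f, 'r, nat \<Rightarrow> 'a) struct" and e where N: "is_struct \<L> N" "countable (universe N)"
    "\<And>\<phi>. \<phi> \<in> theory_of \<L> M \<Longrightarrow> models N \<phi>" "range e \<subseteq> universe N" "\<And>i. sat N e (\<Phi> i)"
    using countable_compactness[where \<Phi> = \<Phi>, OF language struct assms(1) fs] by metis
  obtain h where h: "isomorphism \<L> M N h"
    using omega_categorical_isomorphic[OF categorical N(1,2,3)] by (auto simp: isomorphic_def)
  let ?k = "inv_into (universe M) h"
  have k: "isomorphism \<L> N M ?k" by (rule isomorphism_inv_into[OF struct h])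
  have "env (?k \<circ> e)" using k N(4) by (auto simp: env_def isomorphism_def bij_betw_def)
  moreover have "sat M (?k \<circ> e) (\<Phi> i)" for i
    using isomorphism_sat[OF N(1) k N(4) assms(1)] N(5) by blast
  ultimately show ?thesis by blast
qed

lemma enumerate_tuples:
  "\<exists>c :: nat \<Rightarrow> nat \<Rightarrow> 'a. (\<forall>j. env (c j)) \<and> (\<forall>e. env e \<longrightarrow> (\<exists>j. \<forall>i<n. c j i = e i))"
proof -
  obtain d where d: "d \<in> universe M" using struct by (auto simp: is_struct_def)
  define A where "A = {xs. set xs \<subseteq> universe M \<and> length xs = n}"
  have A: "countable A" unfolding A_def
    by (rule countable_subset[OF _ countable_lists[OF countable_universe]]) auto
  have "replicate n d \<in> A" using d by (auto simp: A_def)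
  then have "A \<noteq> {}" by blast
  then have "from_nat_into A j \<in> A" for j by (rule from_nat_into)
  then have in_A: "set (from_nat_into A j) \<subseteq> universe M" "length (from_nat_into A j) = n" for j
    by (simp_all add: A_def)
  define c where "c j i = (if i < n then from_nat_into A j ! i else d)" for j i
  have "from_nat_into A j ! i \<in> universe M" if "i < n" for i j
    by (rule subsetD[OF in_A(1)], rule nth_mem) (simp add: in_A that)
  then have "env (c j)" for j using d by (auto simp: env_def c_def)
  moreover have "\<exists>j. \<forall>i<n. c j i = e i" if "env e" for e
  proof -
    have "map e [0..<n] \<in> A" using that by (auto simp: env_def A_def)
    then obtain j where "from_nat_into A j = map e [0..<n]"
      using from_nat_into_surj[OF A] by blast
    then show ?thesis by (intro exI[of _ j]) (simp add: c_def)
  qed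
  ultimately show ?thesis by (intro exI[of _ c]) blast
qed

text \<open>If no complete formula implied \<open>\<psi>\<close>, then a chain of ever stronger formulas could be built
  whose \<open>j\<close>-th member is falsified by the \<open>j\<close>-th tuple of \<open>M\<close>; but the chain is realised in \<open>M\<close>.\<close>

lemma complete_below:
  assumes \<psi>: "\<psi> \<in> Fm n" and e: "env e" "sat M e \<psi>"
  shows "\<exists>\<theta>. complete n \<theta> \<and> (\<forall>e. env e \<longrightarrow> sat M e \<theta> \<longrightarrow> sat M e \<psi>)"
proof (rule ccontr)
  assume no: "\<nexists>\<theta>. complete n \<theta> \<and> (\<forall>e. env e \<longrightarrow> sat M e \<theta> \<longrightarrow> sat M e \<psi>)"
  obtain c :: "nat \<Rightarrow> nat \<Rightarrow> 'a" where c: "\<And>j. env (c j)" "\<And>e. env e \<Longrightarrow> \<exists>j. \<forall>i<n. c j i = e i"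
    using enumerate_tuples[of n] by blast
  define P where "P \<theta> \<longleftrightarrow> \<theta> \<in> Fm n \<and> (\<exists>e. env e \<and> sat M e \<theta>) \<and> (\<forall>e. env e \<longrightarrow> sat M e \<theta> \<longrightarrow> sat M e \<psi>)"
    for \<theta>
  have "\<exists>\<theta>. \<forall>j. P (\<theta> j) \<and>
      ((\<forall>e. sat M e (\<theta> (Suc j)) \<longrightarrow> sat M e (\<theta> j)) \<and> \<not> sat M (c j) (\<theta> (Suc j)))"
  proof (rule dependent_nat_choice)
    show "\<exists>\<theta>. P \<theta>" using \<psi> e by (auto simp: P_def)
    fix \<theta> j assume \<theta>: "P \<theta>"
    then have "\<not> complete n \<theta>" using no unfolding P_def by blast
    \<comment> \<open>Some \<open>\<chi>\<close> splits \<open>\<theta>\<close>. Both halves are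
      satisfiable, by \<open>e\<close> and \<open>e'\<close>, so the half that \<open>c j\<close>
      falsifies can be taken as the next member of the chain.\<close>
    then obtain \<chi> e e' where \<chi>: "\<chi> \<in> Fm n" "env e" "env e'" "sat M e \<theta>" "sat M e' \<theta>"
        "sat M e \<chi>" "\<not> sat M e' \<chi>"
      using \<theta> unfolding complete_def P_def by blast
    show "\<exists>\<theta>'. P \<theta>' \<and> ((\<forall>e. sat M e \<theta>' \<longrightarrow> sat M e \<theta>) \<and> \<not> sat M (c j) \<theta>')"
    proof (cases "sat M (c j) \<chi>")
      case True
      then show ?thesis using \<theta> \<chi>
        by (intro exI[of _ "fm_conj \<theta> (fm_neg \<chi>)"]) (auto simp: P_def Fm_def)
    next
      case False
      then show ?thesis using \<theta> \<chi>
        by (intro exI[of _ "fm_conj \<theta> \<chi>"]) (auto simp: P_def Fm_def)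
    qed
  qed
  then obtain \<theta> where \<theta>: "\<And>j. P (\<theta> j)" "\<And>j e. sat M e (\<theta> (Suc j)) \<Longrightarrow> sat M e (\<theta> j)"
      "\<And>j. \<not> sat M (c j) (\<theta> (Suc j))"
    by blast
  have dec: "sat M e (\<theta> k) \<Longrightarrow> sat M e (\<theta> i)" if "i \<le> k" for e i k
    using that by (induction rule: dec_induct) (auto dest: \<theta>(2))
  have "fm_in \<L> (\<theta> k)" for k using \<theta>(1) by (simp add: P_def Fm_def)
  moreover have "\<exists>e. env e \<and> (\<forall>i\<le>k. sat M e (\<theta> i))" for k
    using \<theta>(1)[of k] dec unfolding P_def by blast
  ultimately have "\<exists>e. env e \<and> (\<forall>i. sat M e (\<theta> i))" by (rule realize)
  then obtain e where e: "env e" "\<And>i. sat M e (\<theta> i)" by blast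
  obtain j where "\<forall>i<n. c j i = e i" using c(2) e(1) by blast
  then have "sat M (c j) (\<theta> (Suc j)) = sat M e (\<theta> (Suc j))"
    using \<theta>(1) by (intro sat_Fm_cong) (auto simp: P_def)
  then show False using e(2) \<theta>(3) by blast
qed

text \<open>The formula \<open>fm_ex n \<psi>\<close> has its free variables below \<open>n\<close>,
  so it is decided by the complete \<open>\<theta>\<close>: what can be added to one realisation of
  \<open>\<theta>\<close> can be added to every other.\<close>

lemma complete_ex:
  assumes \<theta>: "complete n \<theta>" "env e" "sat M e \<theta>"
    and \<psi>: "\<psi> \<in> Fm (Suc n)" and e': "env e'" "sat M e' \<theta>" "sat M e' \<psi>"
  obtains c where "c \<in> universe M" "sat M (e(n := c)) \<psi>"
proof -
  have "fm_ex n \<psi> \<in> Fm n" using \<psi> by (auto simp: Fm_def less_Suc_eq)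
  moreover have "sat M e' (fm_ex n \<psi>)"
    using e' env_in[OF e'(1)] by (auto intro!: bexI[of _ "e' n"])
  ultimately have "sat M e (fm_ex n \<psi>)"
    using completeD \<theta> e'(1,2) by blast
  then show ?thesis using that by auto
qed

text \<open>Some complete formula implies \<open>fm_conj \<theta> \<psi>\<close>, but a realisation
  of it need not extend the given tuple. As it satisfies the complete formula
  \<open>\<theta>\<close> of that tuple, its last entry can be traded for a suitable one
  there.\<close>

lemma isolated_extend:
  assumes e: "env e" "isolated n e" and \<psi>: "\<psi> \<in> Fm (Suc n)"
    and c: "c \<in> universe M" "sat M (e(n := c)) \<psi>"
  obtains c' where "c' \<in> universe M" "sat M (e(n := c')) \<psi>" "isolated (Suc n) (e(n := c'))"
proof -
  obtain \<theta> where \<theta>: "complete n \<theta>" "sat M e \<theta>" using e(2) by (auto simp: isolated_def)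
  have \<theta>n: "\<theta> \<in> Fm n" using \<theta>(1) by (rule complete_Fm)
  then have "sat M (e(n := c)) \<theta>" using \<theta>(2) sat_Fm_cong[OF \<theta>n, of e "e(n := c)"] by simp
  then have "sat M (e(n := c)) (fm_conj \<theta> \<psi>)" using c(2) by simp
  moreover have "fm_conj \<theta> \<psi> \<in> Fm (Suc n)" using \<theta>n \<psi> by (auto simp: Fm_def)
  ultimately obtain \<pi> where \<pi>: "complete (Suc n) \<pi>"
      "\<And>e. env e \<Longrightarrow> sat M e \<pi> \<Longrightarrow> sat M e (fm_conj \<theta> \<psi>)"
    using complete_below[of "fm_conj \<theta> \<psi>" "Suc n" "e(n := c)"] env_upd[OF e(1) c(1)] by blast
  then obtain e' where e': "env e'" "sat M e' \<pi>" unfolding complete_def by blast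
  moreover have "\<pi> \<in> Fm (Suc n)" using \<pi>(1) by (rule complete_Fm)
  moreover have "sat M e' \<theta>" using \<pi>(2)[OF e'] by simp
  ultimately obtain c' where c': "c' \<in> universe M" "sat M (e(n := c')) \<pi>"
    using complete_ex[OF \<theta>(1) e(1) \<theta>(2)] by blast
  then have "sat M (e(n := c')) (fm_conj \<theta> \<psi>)" using \<pi>(2) env_upd[OF e(1)] by blast
  then show ?thesis using that[OF c'(1)] c'(2) \<pi>(1) by (auto simp: isolated_def)
qed

lemma isolated_0:
  assumes "env e" shows "isolated 0 e"
proof -
  have "sat M e \<psi> = sat M e' \<psi>" if "\<psi> \<in> Fm 0" for e e' \<psi>
    using that by (rule sat_Fm_cong) simp
  then have "complete 0 fm_true" using assms unfolding complete_def by (auto simp: Fm_def)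
  then show ?thesis by (auto simp: isolated_def)
qed

text \<open>The variable 0 stands for the element that is sought, the variable \<open>i + 1\<close> for \<open>a i\<close>.\<close>

lemma isolated_sequence:
  "\<exists>a. env a \<and> (\<forall>n. isolated n a) \<and>
    (\<forall>\<chi> c. fm_in \<L> \<chi> \<and> c \<in> universe M \<and> sat M (case_nat c a) \<chi> \<longrightarrow> (\<exists>n. sat M (case_nat (a n) a) \<chi>))"
proof -
  let ?F = "{\<phi>. fm_in \<L> \<phi>}"
  \<comment> \<open>Only the first component of the decoded pair matters, so each formula recurs at
    infinitely many stages. In particular it occurs at one so late that its variables refer to
    entries already chosen, which is the condition
    \<open>free_vars (X n) \<subseteq> {..n}\<close>.\<close>
  define X where "X n = from_nat_into ?F (fst (prod_decode n))" for n
  have "?F \<noteq> {}" by (auto intro: exI[of _ Falsum])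
  then have X: "fm_in \<L> (X n)" for n using from_nat_into[of ?F] by (auto simp: X_def)
  define Q where "Q n e e' \<longleftrightarrow> (\<forall>i<n. e' i = e i) \<and> (free_vars (X n) \<subseteq> {..n} \<longrightarrow>
      (\<exists>c\<in>universe M. sat M (case_nat c e) (X n)) \<longrightarrow> sat M (case_nat (e' n) e') (X n))"
    for n and e e' :: "nat \<Rightarrow> 'a"
  have "\<exists>f. \<forall>n. (env (f n) \<and> isolated n (f n)) \<and> Q n (f n) (f (Suc n))"
  proof (rule dependent_nat_choice)
    show "\<exists>e. env e \<and> isolated 0 e"
      using enumerate_tuples[of 0] isolated_0 by blast
    fix e n assume e: "env e \<and> isolated n e"
    show "\<exists>e'. (env e' \<and> isolated (Suc n) e') \<and> Q n e e'"
    proof (cases "free_vars (X n) \<subseteq> {..n} \<and> (\<exists>c\<in>universe M. sat M (case_nat c e) (X n))")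
      case True
      then obtain c where c: "c \<in> universe M" "sat M (case_nat c e) (X n)" by blast
      \<comment> \<open>The sought element becomes entry \<open>n\<close> of the tuple, so variable
        0 is renamed to \<open>n\<close> and \<open>Suc i\<close> back to \<open>i\<close>.\<close>
      obtain \<psi> where \<psi>: "fm_in \<L> \<psi>" "free_vars \<psi> \<subseteq> case_nat n id ` free_vars (X n)"
        "\<And>(M :: ('f, 'r, 'a) struct) e. sat M e \<psi> = sat M (e \<circ> case_nat n id) (X n)"
        using rename_fm[OF X] by blast
      have sub: "sat M (e(n := c)) \<psi> = sat M (case_nat c (e(n := c))) (X n)" for c
        unfolding \<psi>(3) by (rule sat_cong) (auto split: nat.splits)
      also have "\<dots> c = sat M (case_nat c e) (X n)" for c
        using True by (intro sat_cong) (auto split: nat.splits)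
      finally have eq: "sat M (e(n := c)) \<psi> = sat M (case_nat c e) (X n)" for c .
      have "case_nat n id i < Suc n" if "i \<in> free_vars (X n)" for i
        using that True by (auto split: nat.splits)
      then have "\<psi> \<in> Fm (Suc n)" using \<psi>(1,2) by (auto simp: Fm_def)
      then obtain c' where "c' \<in> universe M" "sat M (e(n := c')) \<psi>" "isolated (Suc n) (e(n := c'))"
        using isolated_extend[of e n \<psi> c] e c eq by blast
      then show ?thesis using e sub env_upd
        by (intro exI[of _ "e(n := c')"]) (auto simp: Q_def)
    next
      case False
      have "sat M (e(n := e n)) fm_true" "fm_true \<in> Fm (Suc n)" by (simp_all add: Fm_def)
      then obtain c' where "c' \<in> universe M" "isolated (Suc n) (e(n := c'))"
        using isolated_extend[of e n fm_true "e n"] e env_in by blast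
      then show ?thesis using e False env_upd
        by (intro exI[of _ "e(n := c')"]) (auto simp: Q_def)
    qed
  qed
  then obtain f where f: "\<And>n. env (f n)" "\<And>n. isolated n (f n)" "\<And>n. Q n (f n) (f (Suc n))"
    by blast
  \<comment> \<open>Entry \<open>i\<close> is chosen in passing from stage \<open>i\<close> to stage
    \<open>Suc i\<close> and never changed afterwards.\<close>
  define a where "a i = f (Suc i) i" for i
  have af: "a i = f n i" if "i < n" for i n
  proof -
    have "Suc i \<le> n" using that by simp
    then show ?thesis
    proof (induction rule: dec_induct)
      case (step m)
      then show ?case using f(3)[of m] by (simp add: Q_def)
    qed (simp add: a_def)
  qed
  have "env a" using env_in[OF f(1)] by (auto simp: env_def a_def)
  moreover have "isolated n a" for n
    by (rule isolated_cong[OF f(2)]) (simp add: af)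
  moreover have "\<exists>n. sat M (case_nat (a n) a) \<chi>"
    if \<chi>: "fm_in \<L> \<chi>" and c: "c \<in> universe M" "sat M (case_nat c a) \<chi>" for \<chi> c
  proof -
    obtain j where j: "from_nat_into ?F j = \<chi>"
      using from_nat_into_surj[OF countable_fm_in[OF language]] \<chi> by blast
    obtain m where m: "\<And>i. i \<in> free_vars \<chi> \<Longrightarrow> i < m"
      using finite_free_vars[of \<chi>] by (meson finite_nat_set_iff_bounded)
    define n where "n = prod_encode (j, m)"
    have Xn: "X n = \<chi>" by (simp add: X_def n_def j)
    have "m \<le> n" by (simp add: n_def le_prod_encode_2)
    then have fv: "i \<le> n" if "i \<in> free_vars \<chi>" for i using m[OF that] by simp
    have "sat M (case_nat c (f n)) \<chi>"
    proof -
      have "sat M (case_nat c (f n)) \<chi> = sat M (case_nat c a) \<chi>"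
        by (intro sat_cong) (auto split: nat.splits dest!: fv simp flip: af)
      then show ?thesis using c(2) by simp
    qed
    then have "sat M (case_nat (f (Suc n) n) (f (Suc n))) \<chi>"
      using f(3)[of n] c(1) fv unfolding Q_def Xn by blast
    moreover have "sat M (case_nat (f (Suc n) n) (f (Suc n))) \<chi> = sat M (case_nat (a n) a) \<chi>"
      by (intro sat_cong) (auto split: nat.splits dest!: fv simp flip: af)
    ultimately show ?thesis by blast
  qed
  ultimately show ?thesis by (intro exI[of _ a]) blast
qed

lemma trm_val_universe: "trm_val (M\<lparr>universe := A\<rparr>) e t = trm_val M e t"
  by (induction t) (auto intro!: arg_cong[where f = "interp_fun M _"])

text \<open>The sequence just built meets the Tarski-Vaught criterion, so its range is a countable
  model of the theory of \<open>M\<close>. An isomorphism from this model to \<open>M\<close>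
  preserves the isolating formulas and turns the sequence into an enumeration of all of
  \<open>M\<close>.\<close>

lemma isolated_enumeration:
  "\<exists>b. range b = universe M \<and> (\<forall>n. isolated n b)"
proof -
  obtain a where a: "env a" "\<And>n. isolated n a"
    "\<And>\<chi> c. fm_in \<L> \<chi> \<Longrightarrow> c \<in> universe M \<Longrightarrow> sat M (case_nat c a) \<chi> \<Longrightarrow> \<exists>n. sat M (case_nat (a n) a) \<chi>"
    using isolated_sequence by blast
  let ?N = "M\<lparr>universe := range a\<rparr>"
  have sub: "sat ?N e \<phi> = sat M e \<phi>" if "range e \<subseteq> range a" "fm_in \<L> \<phi>" for e \<phi>
    using that
  proof (induction \<phi> arbitrary: e)
    case (All n \<phi>)
    have IH: "sat ?N (e(n := c)) \<phi> = sat M (e(n := c)) \<phi>" if "c \<in> range a" for c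
    proof (rule All.IH)
      show "range (e(n := c)) \<subseteq> range a" using that All.prems(1) by auto
    qed (use All.prems in simp)
    have "\<forall>i. \<exists>j. e i = a j" using All.prems(1) by auto
    then obtain \<sigma> where \<sigma>: "\<And>i. e i = a (\<sigma> i)" by metis
    \<comment> \<open>The criterion is available for parameters listed by \<open>a\<close> only.
      Thus every variable is redirected to an index of its value in \<open>a\<close>, shifted by
      one, and the quantified variable \<open>n\<close> to 0.\<close>
    obtain \<psi> where \<psi>: "fm_in \<L> \<psi>"
      "\<And>(M :: ('f, 'r, 'a) struct) e. sat M e \<psi> = sat M (e \<circ> (\<lambda>i. if i = n then 0 else Suc (\<sigma> i))) \<phi>"
      using rename_fm[of \<L> \<phi>] All.prems(2) by (metis fm_in.simps(5))
    have eq: "sat M (case_nat c a) \<psi> = sat M (e(n := c)) \<phi>" for c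
      unfolding \<psi>(2) by (rule sat_cong) (auto simp: \<sigma>)
    have "(\<forall>c\<in>universe M. sat M (e(n := c)) \<phi>) \<longleftrightarrow> (\<forall>c\<in>range a. sat M (e(n := c)) \<phi>)"
    proof
      assume *: "\<forall>c\<in>range a. sat M (e(n := c)) \<phi>"
      show "\<forall>c\<in>universe M. sat M (e(n := c)) \<phi>"
      proof (rule ccontr)
        assume "\<not> (\<forall>c\<in>universe M. sat M (e(n := c)) \<phi>)"
        then obtain c where "c \<in> universe M" "sat M (case_nat c a) (fm_neg \<psi>)"
          using eq by auto
        then obtain m where "sat M (case_nat (a m) a) (fm_neg \<psi>)"
          using a(3)[of "fm_neg \<psi>" c] \<psi>(1) by auto
        then show False using * eq by auto
      qed
    qed (use a(1) in \<open>auto simp: env_def\<close>)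
    then show ?case using IH by simp
  next
    case (Rel r ts)
    have "map (trm_val ?N e) ts = map (trm_val M e) ts" by (simp add: trm_val_universe)
    then show ?case by (simp del: map_eq_conv)
  qed (auto simp: trm_val_universe)
  have N: "is_struct \<L> ?N"
    unfolding is_struct_def
  proof (intro conjI ballI)
    fix f xs assume f: "f \<in> funs \<L>" and xs: "xs \<in> arguments ?N (farity \<L> f)"
    then have "\<forall>x\<in>set xs. \<exists>i. x = a i" by (auto simp: arguments_def)
    then obtain p where p: "\<And>x. x \<in> set xs \<Longrightarrow> a (p x) = x" by metis
    \<comment> \<open>The same criterion gives closure under functions, as the value is the only
      solution of this equation.\<close>
    let ?\<chi> = "Eq (Var 0) (App f (map (\<lambda>x. Var (Suc (p x))) xs))"
    have v: "sat M (case_nat c a) ?\<chi> \<longleftrightarrow> c = interp_fun M f xs" for c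
    proof -
      have "map (\<lambda>x. a (p x)) xs = xs" using p by (intro map_idI)
      then show ?thesis by (simp add: o_def)
    qed
    have "xs \<in> arguments M (farity \<L> f)" using xs a(1) by (auto simp: arguments_def env_def)
    then have "interp_fun M f xs \<in> universe M" using struct f by (auto simp: is_struct_def)
    moreover have "fm_in \<L> ?\<chi>" using f xs by (auto simp: arguments_def list_all_iff)
    ultimately obtain n where "a n = interp_fun M f xs" using a(3) v by blast
    then have "interp_fun M f xs \<in> range a" by (metis rangeI)
    then show "interp_fun ?N f xs \<in> universe ?N" by simp
  qed simp
  have "models ?N \<phi>" if "\<phi> \<in> theory_of \<L> M" for \<phi>
    unfolding models_def
  proof (intro allI impI)
    fix e :: "nat \<Rightarrow> 'a" assume "range e \<subseteq> universe ?N"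
    then have e: "range e \<subseteq> range a" by simp
    then have "range e \<subseteq> universe M" using a(1) by (auto simp: env_def)
    then have "sat M e \<phi>" using that by (simp add: models_def theory_of_def)
    then show "sat ?N e \<phi>" using sub[OF e] that by (simp add: theory_of_def)
  qed
  moreover have "countable (universe ?N)" by simp
  ultimately obtain h where h: "isomorphism \<L> M ?N h"
    using omega_categorical_isomorphic[OF categorical N] unfolding isomorphic_def by blast
  let ?k = "inv_into (universe M) h"
  have k: "isomorphism \<L> ?N M ?k" by (rule isomorphism_inv_into[OF struct h])
  have "?k ` range a = universe M" using k by (simp add: isomorphism_def bij_betw_def)
  then have "range (?k \<circ> a) = universe M" by (simp add: image_comp)
  moreover have "\<forall>n. isolated n (?k \<circ> a)"
  proof
    fix n
    obtain \<theta> where \<theta>: "complete n \<theta>" "sat M a \<theta>" using a(2) by (auto simp: isolated_def)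
    then have "fm_in \<L> \<theta>" using complete_Fm by (auto simp: Fm_def)
    then have "sat M (?k \<circ> a) \<theta>" using isomorphism_sat[OF N k, of a \<theta>] sub[of a \<theta>] \<theta>(2) by simp
    then show "isolated n (?k \<circ> a)" using \<theta>(1) by (auto simp: isolated_def)
  qed
  ultimately show ?thesis by (intro exI[of _ "?k \<circ> a"] conjI)
qed

text \<open>If \<open>\<theta>(z\<^sub>0, \<dots>, z\<^sub>k)\<close> isolates the type of \<open>b\<close>, then
  \<open>\<exists>z. \<theta>(z) \<and> (\<forall>i<n. x i = z (\<sigma> i))\<close> isolates the type of \<open>b \<circ> \<sigma>\<close>.\<close>

lemma isolated_comp:
  assumes b: "env b" "isolated k b" and \<sigma>: "\<And>i. i < n \<Longrightarrow> \<sigma> i < k"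
  shows "isolated n (b \<circ> \<sigma>)"
proof -
  obtain \<theta> where \<theta>: "complete k \<theta>" "sat M b \<theta>" using b(2) by (auto simp: isolated_def)
  have \<theta>k: "fm_in \<L> \<theta>" "free_vars \<theta> \<subseteq> {..<k}" using complete_Fm[OF \<theta>(1)] by (auto simp: Fm_def)
  \<comment> \<open>The shift by \<open>n\<close> separates the quantified variables, which occupy
    \<open>n, ..., n + k - 1\<close>, from the free ones below \<open>n\<close>.\<close>
  obtain \<theta>' where \<theta>': "fm_in \<L> \<theta>'" "free_vars \<theta>' \<subseteq> (+) n ` free_vars \<theta>"
    "\<And>(M :: ('f, 'r, 'a) struct) e. sat M e \<theta>' = sat M (e \<circ> (+) n) \<theta>"
    using rename_fm[OF \<theta>k(1)] by blast
  define \<pi> where "\<pi> = foldr fm_ex [n..<n + k]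
      (foldr fm_conj (map (\<lambda>i. Eq (Var i) (Var (n + \<sigma> i))) [0..<n]) \<theta>')"
  have \<pi>: "sat M e \<pi> \<longleftrightarrow> (\<exists>d. env d \<and> (\<forall>i<n. d i = e i) \<and> (\<forall>i<n. d i = d (n + \<sigma> i)) \<and> sat M (d \<circ> (+) n) \<theta>)"
    if e: "env e" for e
  proof
    assume "sat M e \<pi>"
    then obtain d where "range d \<subseteq> universe M" "\<forall>i. i \<notin> set [n..<n + k] \<longrightarrow> d i = e i"
        "sat M d (foldr fm_conj (map (\<lambda>i. Eq (Var i) (Var (n + \<sigma> i))) [0..<n]) \<theta>')"
      using e unfolding \<pi>_def env_def by (simp add: sat_ex_list) blast
    then show "\<exists>d. env d \<and> (\<forall>i<n. d i = e i) \<and> (\<forall>i<n. d i = d (n + \<sigma> i)) \<and> sat M (d \<circ> (+) n) \<theta>"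
      unfolding env_def by (intro exI[of _ d]) (simp add: sat_conj_list \<theta>'(3))
  next
    assume "\<exists>d. env d \<and> (\<forall>i<n. d i = e i) \<and> (\<forall>i<n. d i = d (n + \<sigma> i)) \<and> sat M (d \<circ> (+) n) \<theta>"
    then obtain d where d: "env d" "\<forall>i<n. d i = e i" "\<forall>i<n. d i = d (n + \<sigma> i)" "sat M (d \<circ> (+) n) \<theta>"
      by blast
    \<comment> \<open>The quantifier block changes only finitely many variables, so the witness has
      to agree with \<open>e\<close> from \<open>n + k\<close> on. Truth of \<open>\<theta>\<close>
      does not depend on those values.\<close>
    let ?d = "\<lambda>i. if i < n + k then d i else e i"
    have "sat M (?d \<circ> (+) n) \<theta> = sat M (d \<circ> (+) n) \<theta>"
      using \<theta>k(2) by (intro sat_cong) auto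
    moreover have "range ?d \<subseteq> universe M" using d(1) e by (auto simp: env_def)
    moreover have "?d i = ?d (n + \<sigma> i)" if "i < n" for i
      using \<sigma>[OF that] d(3) that by simp
    moreover have "\<forall>i. i \<notin> set [n..<n + k] \<longrightarrow> ?d i = e i" using d(2) by auto
    ultimately show "sat M e \<pi>"
      using d(4) e unfolding \<pi>_def env_def
      by (subst sat_ex_list) (blast, intro exI[of _ ?d] conjI, simp_all add: sat_conj_list \<theta>'(3))
  qed
  have "complete n \<pi>"
    unfolding complete_def
  proof (intro conjI ballI allI impI)
    have "fm_in \<L> \<pi>" using \<theta>' by (auto simp: \<pi>_def fm_in_foldr_ex fm_in_foldr_conj)
    moreover have "free_vars \<pi> \<subseteq> {..<n}"
      using \<theta>'(2) \<theta>k(2) \<sigma> by (fastforce simp: \<pi>_def free_vars_foldr_ex free_vars_foldr_conj)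
    ultimately show "\<pi> \<in> Fm n" by (simp add: Fm_def)
    \<comment> \<open>This assignment is the tuple \<open>b \<circ> \<sigma>\<close> on the first
      \<open>n\<close> variables, followed by \<open>b\<close> itself in the shifted
      positions.\<close>
    let ?d = "\<lambda>i. if i < n then b (\<sigma> i) else b (i - n)"
    have "env ?d" "?d \<circ> (+) n = b" using b(1) by (auto simp: env_def)
    then have "env ?d \<and> sat M ?d \<pi>" using \<pi>[of ?d] \<theta>(2) by (auto intro!: exI[of _ ?d])
    then show "\<exists>e. env e \<and> sat M e \<pi>" by (rule exI[of _ ?d])
    fix \<psi> e e'
    assume \<psi>: "\<psi> \<in> Fm n" and *: "env e \<and> env e' \<and> sat M e \<pi> \<and> sat M e' \<pi>"
    obtain d where d: "env d" "\<forall>i<n. d i = e i" "\<forall>i<n. d i = d (n + \<sigma> i)" "sat M (d \<circ> (+) n) \<theta>"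
      using \<pi>[of e] * by blast
    obtain d' where
      d': "env d'" "\<forall>i<n. d' i = e' i" "\<forall>i<n. d' i = d' (n + \<sigma> i)" "sat M (d' \<circ> (+) n) \<theta>"
      using \<pi>[of e'] * by blast
    have "fm_in \<L> \<psi>" using \<psi> by (simp add: Fm_def)
    \<comment> \<open>A statement \<open>\<psi>\<close> about the short tuple is a statement
      \<open>\<psi>'\<close> about the long one, of which it is a part, and there
      \<open>\<theta>\<close> decides it.\<close>
    then obtain \<psi>' where \<psi>': "fm_in \<L> \<psi>'" "free_vars \<psi>' \<subseteq> \<sigma> ` free_vars \<psi>"
      "\<And>(M :: ('f, 'r, 'a) struct) e. sat M e \<psi>' = sat M (e \<circ> \<sigma>) \<psi>"
      using rename_fm by blast
    have "\<psi>' \<in> Fm k" using \<psi>' \<psi> \<sigma> by (fastforce simp: Fm_def)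
    moreover have "env (d \<circ> (+) n)" "env (d' \<circ> (+) n)" using d(1) d'(1) by (auto simp: env_def)
    ultimately have "sat M (d \<circ> (+) n) \<psi>' = sat M (d' \<circ> (+) n) \<psi>'"
      using completeD[OF \<theta>(1)] d(4) d'(4) by blast
    moreover have "sat M (d \<circ> (+) n) \<psi>' = sat M e \<psi>"
      unfolding \<psi>'(3) using d(2,3) by (intro sat_Fm_cong[OF \<psi>]) auto
    moreover have "sat M (d' \<circ> (+) n) \<psi>' = sat M e' \<psi>"
      unfolding \<psi>'(3) using d'(2,3) by (intro sat_Fm_cong[OF \<psi>]) auto
    ultimately show "sat M e \<psi> = sat M e' \<psi>" by simp
  qed
  moreover have "sat M (b \<circ> \<sigma>) \<pi>"
  proof -
    let ?d = "\<lambda>i. if i < n then b (\<sigma> i) else b (i - n)"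
    have "env ?d" "?d \<circ> (+) n = b" "env (b \<circ> \<sigma>)" using b(1) by (auto simp: env_def)
    then show ?thesis using \<pi>[of "b \<circ> \<sigma>"] \<theta>(2) by (auto intro!: exI[of _ ?d])
  qed
  ultimately show ?thesis by (auto simp: isolated_def)
qed

text \<open>\<open>M\<close> is atomic: an arbitrary tuple selects entries of the enumeration
  \<open>b\<close>, possibly with repetitions, and only finitely many of them, so it is a subtuple
  of an initial segment of \<open>b\<close>.\<close>

lemma all_isolated:
  assumes "env e" shows "isolated n e"
proof -
  obtain b where b: "range b = universe M" "\<And>n. isolated n b"
    using isolated_enumeration by blast
  have "e i \<in> range b" for i using env_in[OF assms] b(1) by simp
  then have "\<forall>i. \<exists>j. e i = b j" by auto
  then obtain \<sigma> where \<sigma>: "\<And>i. e i = b (\<sigma> i)" by metis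
  obtain k where "\<And>i. i < n \<Longrightarrow> \<sigma> i < k"
    using finite_nat_set_iff_bounded[of "\<sigma> ` {..<n}"] by auto
  then have "isolated n (b \<circ> \<sigma>)" using b by (intro isolated_comp) (auto simp: env_def)
  moreover have "b \<circ> \<sigma> = e" using \<sigma> by auto
  ultimately show ?thesis by simp
qed

section \<open>Finiteness of the set of types and conjugacy of tuples\<close>

text \<open>If no finite set of complete formulas covered all tuples, the negations of all complete
  formulas would be finitely satisfiable, hence jointly realised in \<open>M\<close> by a tuple that
  is not isolated.\<close>

lemma finitely_many_complete:
  "\<exists>T. finite T \<and> (\<forall>\<theta>\<in>T. complete n \<theta>) \<and> (\<forall>e. env e \<longrightarrow> (\<exists>\<theta>\<in>T. sat M e \<theta>))"
proof (rule ccontr)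
  assume no: "\<not> ?thesis"
  define C where "C = {\<theta>. complete n \<theta>}"
  have "C \<subseteq> {\<phi>. fm_in \<L> \<phi>}" using complete_Fm by (auto simp: C_def Fm_def)
  then have C: "countable C" using countable_fm_in[OF language] by (rule countable_subset)
  obtain e where "env e" using enumerate_tuples[of 0] by blast
  then have "C \<noteq> {}" using all_isolated[of e n] by (auto simp: isolated_def C_def)
  then have in_C: "from_nat_into C k \<in> C" for k by (rule from_nat_into)
  have "\<exists>e. env e \<and> (\<forall>i\<le>k. sat M e (fm_neg (from_nat_into C i)))" for k
  proof (rule ccontr)
    assume "\<not> ?thesis"
    then have "\<forall>e. env e \<longrightarrow> (\<exists>\<theta>\<in>from_nat_into C ` {..k}. sat M e \<theta>)" by auto
    moreover have "\<forall>\<theta>\<in>from_nat_into C ` {..k}. complete n \<theta>" using in_C by (auto simp: C_def)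
    moreover have "finite (from_nat_into C ` {..k})" by simp
    ultimately show False using no by blast
  qed
  moreover have "fm_in \<L> (fm_neg (from_nat_into C i))" for i
    using in_C[of i] complete_Fm by (auto simp: C_def Fm_def)
  ultimately obtain e where e: "env e" "\<And>i. sat M e (fm_neg (from_nat_into C i))"
    using realize[of "\<lambda>i. fm_neg (from_nat_into C i)"] by blast
  obtain \<theta> where \<theta>: "\<theta> \<in> C" "sat M e \<theta>" using all_isolated[OF e(1)] by (auto simp: isolated_def C_def)
  then obtain i where "from_nat_into C i = \<theta>" using from_nat_into_surj[OF C] by blast
  then show False using e(2)[of i] \<theta>(2) by simp
qed

lemma same_type_extend:
  assumes e: "env e" "env e'" "complete n \<theta>" "sat M e \<theta>" "sat M e' \<theta>" and c: "c \<in> universe M"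
  shows "\<exists>c'\<in>universe M. \<exists>\<pi>. complete (Suc n) \<pi> \<and> sat M (e(n := c)) \<pi> \<and> sat M (e'(n := c')) \<pi>"
proof -
  obtain \<pi> where \<pi>: "complete (Suc n) \<pi>" "sat M (e(n := c)) \<pi>"
    using all_isolated[OF env_upd[OF e(1) c]] by (auto simp: isolated_def)
  have "sat M (e(n := c)) \<theta>"
    using sat_Fm_cong[OF complete_Fm[OF e(3)], of e "e(n := c)"] e(4) by simp
  then show ?thesis
    using complete_ex[OF e(3,2,5) complete_Fm[OF \<pi>(1)] env_upd[OF e(1) c]] \<pi> by metis
qed

text \<open>Back and forth on a pair of assignments. Stage \<open>k\<close> puts \<open>u k\<close>
  at position \<open>n + 2 * k\<close> of the first and at position \<open>n + 2 * k + 1\<close> of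
  the second, so both limits enumerate the universe. Initial segments always satisfy a common
  complete formula; hence the limits satisfy the same formulas, and matching their entries is an
  automorphism.\<close>

lemma same_type_automorphism:
  assumes e: "env e" "env e'" "complete n \<theta>" "sat M e \<theta>" "sat M e' \<theta>"
  shows "\<exists>g. isomorphism \<L> M M g \<and> (\<forall>i<n. g (e i) = e' i)"
proof -
  define u where "u = from_nat_into (universe M)"
  have ne: "universe M \<noteq> {}" using struct by (simp add: is_struct_def)
  have u: "u k \<in> universe M" for k using from_nat_into[OF ne] by (simp add: u_def)
  have u_surj: "\<exists>k. u k = c" if "c \<in> universe M" for c
    using from_nat_into_surj[OF countable_universe that] by (simp add: u_def)
  \<comment> \<open>The last conjunct anchors the construction at the given pair, since dependent
    choice reveals about its first member only that it satisfies \<open>P 0\<close>.\<close>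
  define P where "P k p \<longleftrightarrow> env (fst p) \<and> env (snd p) \<and>
      (\<exists>\<theta>. complete (n + 2 * k) \<theta> \<and> sat M (fst p) \<theta> \<and> sat M (snd p) \<theta>) \<and>
      (k = 0 \<longrightarrow> p = (e, e'))" for k and p :: "(nat \<Rightarrow> 'a) \<times> (nat \<Rightarrow> 'a)"
  define Q where "Q k p q \<longleftrightarrow> (\<forall>i<n + 2 * k. fst q i = fst p i \<and> snd q i = snd p i) \<and>
      fst q (n + 2 * k) = u k \<and> snd q (Suc (n + 2 * k)) = u k"
    for k and p q :: "(nat \<Rightarrow> 'a) \<times> (nat \<Rightarrow> 'a)"
  have "\<exists>f. \<forall>k. P k (f k) \<and> Q k (f k) (f (Suc k))"
  proof (rule dependent_nat_choice)
    show "\<exists>p. P 0 p" using e by (auto simp: P_def)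
    fix p k assume "P k p"
    then obtain \<theta> where p: "env (fst p)" "env (snd p)"
      "complete (n + 2 * k) \<theta>" "sat M (fst p) \<theta>" "sat M (snd p) \<theta>"
      by (auto simp: P_def)
    let ?m = "n + 2 * k"
    obtain c \<pi> where c: "c \<in> universe M" "complete (Suc ?m) \<pi>" "sat M ((fst p)(?m := u k)) \<pi>"
      "sat M ((snd p)(?m := c)) \<pi>"
      using same_type_extend[OF p u] by blast
    obtain d \<rho> where d: "d \<in> universe M" "complete (Suc (Suc ?m)) \<rho>"
      "sat M ((snd p)(?m := c, Suc ?m := u k)) \<rho>" "sat M ((fst p)(?m := u k, Suc ?m := d)) \<rho>"
      using same_type_extend[OF env_upd[OF p(2) c(1)] env_upd[OF p(1) u] c(2,4,3) u] by blast
    show "\<exists>q. P (Suc k) q \<and> Q k p q"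
      by (intro exI[of _ "((fst p)(?m := u k, Suc ?m := d), (snd p)(?m := c, Suc ?m := u k))"])
        (use p c d u env_upd in \<open>auto simp: P_def Q_def\<close>)
  qed
  then obtain f where P: "\<And>k. P k (f k)" and Q: "\<And>k. Q k (f k) (f (Suc k))" by blast
  define E where "E i = fst (f (Suc i)) i" for i
  define E' where "E' i = snd (f (Suc i)) i" for i
  have stable: "fst (f k') i = fst (f k) i \<and> snd (f k') i = snd (f k) i"
    if "k \<le> k'" "i < n + 2 * k" for k k' i
    using that(1)
  proof (induction rule: dec_induct)
    case (step m)
    then show ?case using Q[of m] that by (simp add: Q_def)
  qed simp
  have E: "E i = fst (f k) i" "E' i = snd (f k) i" if "i < n + 2 * k" for i k
  proof -
    have "fst (f (max k (Suc i))) i = fst (f k) i \<and> snd (f (max k (Suc i))) i = snd (f k) i"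
      "fst (f (max k (Suc i))) i = fst (f (Suc i)) i \<and> snd (f (max k (Suc i))) i = snd (f (Suc i)) i"
      using that by (auto intro!: stable)
    then show "E i = fst (f k) i" "E' i = snd (f k) i" by (simp_all add: E_def E'_def)
  qed
  have envE: "env E" "env E'" using P env_in by (auto simp: env_def E_def E'_def P_def)
  have "universe M \<subseteq> range E" "universe M \<subseteq> range E'"
  proof -
    have "E (n + 2 * k) = u k" "E' (Suc (n + 2 * k)) = u k" for k
      using Q[of k] E[of "n + 2 * k" "Suc k"] E[of "Suc (n + 2 * k)" "Suc k"] by (simp_all add: Q_def)
    then show "universe M \<subseteq> range E" "universe M \<subseteq> range E'"
      using u_surj by (metis rangeI subsetI)+
  qed
  then have rE: "range E = universe M" "range E' = universe M" using envE by (auto simp: env_def)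
  have EE': "sat M E \<phi> = sat M E' \<phi>" if \<phi>: "fm_in \<L> \<phi>" for \<phi>
  proof -
    obtain k where k: "\<And>i. i \<in> free_vars \<phi> \<Longrightarrow> i < k"
      using finite_free_vars[of \<phi>] by (meson finite_nat_set_iff_bounded)
    have k': "i < n + 2 * k" if "i \<in> free_vars \<phi>" for i using k[OF that] by simp
    then have \<phi>': "\<phi> \<in> Fm (n + 2 * k)" using \<phi> by (auto simp: Fm_def)
    obtain \<theta> where "complete (n + 2 * k) \<theta>" "sat M (fst (f k)) \<theta>" "sat M (snd (f k)) \<theta>"
      "env (fst (f k))" "env (snd (f k))"
      using P[of k] by (auto simp: P_def)
    then have "sat M (fst (f k)) \<phi> = sat M (snd (f k)) \<phi>" using completeD[OF _ \<phi>'] by blast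
    moreover have "sat M (fst (f k)) \<phi> = sat M E \<phi>" "sat M (snd (f k)) \<phi> = sat M E' \<phi>"
      using E by (auto intro!: sat_Fm_cong[OF \<phi>'])
    ultimately show ?thesis by simp
  qed
  \<comment> \<open>Entries may repeat in both enumerations. Since equations between variables
    belong to the type, they repeat at the same places, which makes \<open>g\<close> well defined
    and injective.\<close>
  have inj: "E i = E j \<longleftrightarrow> E' i = E' j" for i j using EE'[of "Eq (Var i) (Var j)"] by simp
  define p where "p = inv_into UNIV E"
  have p: "E (p x) = x" if "x \<in> universe M" for x
    using that rE(1) by (metis f_inv_into_f p_def)
  define g where "g = E' \<circ> p"
  have g: "g (E i) = E' i" for i
    using p[OF env_in[OF envE(1)]] inj by (simp add: g_def)
  have "isomorphism \<L> M M g"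
    unfolding isomorphism_def
  proof (intro conjI ballI)
    have "inj_on g (universe M)"
    proof (rule inj_onI)
      fix x y assume "x \<in> universe M" "y \<in> universe M" "g x = g y"
      then show "x = y" using inj[of "p x" "p y"] p by (simp add: g_def)
    qed
    moreover have "g ` universe M = range E'" unfolding rE(1)[symmetric] image_image g ..
    ultimately show "bij_betw g (universe M) (universe M)" using rE(2) by (simp add: bij_betw_def)
  next
    fix h xs assume h: "h \<in> funs \<L>" and xs: "xs \<in> arguments M (farity \<L> h)"
    have px: "map E (map p xs) = xs" using xs p by (auto simp: arguments_def intro!: map_idI)
    let ?y = "interp_fun M h xs"
    have y: "?y \<in> universe M" using struct h xs by (auto simp: is_struct_def)
    let ?\<phi> = "Eq (App h (map Var (map p xs))) (Var (p ?y))"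
    have "fm_in \<L> ?\<phi>" using h xs by (auto simp: arguments_def list_all_iff)
    moreover have v: "sat M d ?\<phi> \<longleftrightarrow> interp_fun M h (map d (map p xs)) = d (p ?y)" for d
      by (simp add: o_def)
    moreover have "sat M E ?\<phi>" unfolding v px p[OF y] ..
    ultimately have "interp_fun M h (map E' (map p xs)) = E' (p ?y)" using EE' v by blast
    then show "g ?y = interp_fun M h (map g xs)" by (simp add: g_def o_def)
  next
    fix r xs assume r: "r \<in> rels \<L>" and xs: "xs \<in> arguments M (rarity \<L> r)"
    have px: "map E (map p xs) = xs" using xs p by (auto simp: arguments_def intro!: map_idI)
    let ?\<phi> = "Rel r (map Var (map p xs))"
    have "fm_in \<L> ?\<phi>" using r xs by (auto simp: arguments_def list_all_iff)
    moreover have v: "sat M d ?\<phi> \<longleftrightarrow> interp_rel M r (map d (map p xs))" for d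
      by (simp add: o_def)
    ultimately have "interp_rel M r (map E (map p xs)) \<longleftrightarrow> interp_rel M r (map E' (map p xs))"
      using EE' by metis
    then show "interp_rel M r xs = interp_rel M r (map g xs)" unfolding px by (simp add: g_def o_def)
  qed
  moreover have "g (e i) = e' i" if "i < n" for i
    using g[of i] E[of i 0] P[of 0] that by (simp add: P_def)
  ultimately show ?thesis by blast
qed

end

section \<open>Roelcke precompactness\<close>

lemma double_coset_eq:
  fixes G (structure)
  shows "(V #> x) <#> V = {a \<otimes> x \<otimes> b | a b. a \<in> V \<and> b \<in> V}"
  by (auto simp: r_coset_def set_mult_def)

lemma (in group) double_coset_cong:
  assumes V: "subgroup V G" and y: "y \<in> carrier G" and uv: "u \<in> V" "v \<in> V"
  shows "(V #> (u \<otimes> y \<otimes> v)) <#> V = (V #> y) <#> V"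
proof -
  interpret V: subgroup V G by (rule V)
  note [simp] = V.mem_carrier y
  show ?thesis
    unfolding double_coset_eq
  proof (intro Set.set_eqI iffI)
    fix z assume "z \<in> {a \<otimes> (u \<otimes> y \<otimes> v) \<otimes> b |a b. a \<in> V \<and> b \<in> V}"
    then obtain a b where ab: "a \<in> V" "b \<in> V" "z = a \<otimes> (u \<otimes> y \<otimes> v) \<otimes> b" by blast
    then have "z = (a \<otimes> u) \<otimes> y \<otimes> (v \<otimes> b)" using uv by (simp add: m_assoc)
    then show "z \<in> {a \<otimes> y \<otimes> b |a b. a \<in> V \<and> b \<in> V}" using ab uv by blast
  next
    fix z assume "z \<in> {a \<otimes> y \<otimes> b |a b. a \<in> V \<and> b \<in> V}"
    then obtain a b where ab: "a \<in> V" "b \<in> V" "z = a \<otimes> y \<otimes> b" by blast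
    have "(a \<otimes> inv u) \<otimes> (u \<otimes> y \<otimes> v) \<otimes> (inv v \<otimes> b) = a \<otimes> (inv u \<otimes> u) \<otimes> y \<otimes> (v \<otimes> inv v) \<otimes> b"
      using ab(1,2) uv by (simp only: m_assoc V.mem_carrier y m_closed inv_closed)
    then have "z = (a \<otimes> inv u) \<otimes> (u \<otimes> y \<otimes> v) \<otimes> (inv v \<otimes> b)"
      using ab uv by simp
    moreover have "a \<otimes> inv u \<in> V" "inv v \<otimes> b \<in> V" using ab uv by simp_all
    ultimately show "z \<in> {a \<otimes> (u \<otimes> y \<otimes> v) \<otimes> b |a b. a \<in> V \<and> b \<in> V}" by blast
  qed
qed

lemma finite_image_factor:
  assumes "finite (f ` A)" "\<And>x y. x \<in> A \<Longrightarrow> y \<in> A \<Longrightarrow> f x = f y \<Longrightarrow> g x = g y"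
  shows "finite (g ` A)"
proof -
  have "g x = g (inv_into A f (f x))" if "x \<in> A" for x
    using that by (intro assms(2)) (auto simp: inv_into_into f_inv_into_f)
  then have "g ` A \<subseteq> (\<lambda>t. g (inv_into A f t)) ` f ` A" by blast
  then show ?thesis using assms(1) by (meson finite_imageI finite_subset)
qed

lemma mult_Aut_apply:
  assumes "g \<in> carrier (Aut \<L> M)" "h \<in> carrier (Aut \<L> M)" "a \<in> universe M"
  shows "(g \<otimes>\<^bsub>Aut \<L> M\<^esub> h) a = g (h a)"
  using assms by (simp add: mult_Aut compose_def)

lemma restrict_isomorphism_Aut:
  assumes M: "is_struct \<L> M" and g: "isomorphism \<L> M M g"
  shows "restrict g (universe M) \<in> carrier (Aut \<L> M)"
proof -
  have m: "map (restrict g (universe M)) xs = map g xs" if "xs \<in> arguments M n" for xs n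
    using that by (auto simp: arguments_def)
  have "bij_betw (restrict g (universe M)) (universe M) (universe M)"
    using g by (simp add: isomorphism_def bij_betw_restrict_eq)
  then have "restrict g (universe M) \<in> Bij (universe M)" by (simp add: Bij_def)
  moreover have "isomorphism \<L> M M (restrict g (universe M))"
    using g M \<open>bij_betw _ _ _\<close> unfolding isomorphism_def is_struct_def
    by (simp add: m cong: ball_cong)
  ultimately show ?thesis by (simp add: carrier_Aut)
qed

text \<open>An open subgroup \<open>V\<close> is pulled back along the isomorphism to an open
  subgroup of \<open>G\<close>. By surjectivity each double coset of \<open>V\<close> is the image
  of a double coset of the preimage, so there are no more of them.\<close>

lemma roelcke_precompact_isomorphic:
  fixes G (structure) and H (structure)
  assumes G: "group G" "topspace T = carrier G" and H: "group H"
    and rp: "roelcke_precompact G T" and iso: "isomorphic_topological_groups G T H W"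
  shows "roelcke_precompact H W"
  unfolding roelcke_precompact_def
proof (intro allI impI)
  fix V assume V: "subgroup V H \<and> openin W V"
  obtain \<phi> where \<phi>: "\<phi> \<in> iso G H" "homeomorphic_map T W \<phi>"
    using iso by (auto simp: isomorphic_topological_groups_def)
  interpret group_hom G H \<phi>
    using G H \<phi>(1) by (simp add: group_hom_def group_hom_axioms_def iso_def)
  interpret V: subgroup V H using V by simp
  have surj: "\<phi> ` carrier G = carrier H" using \<phi>(1) by (simp add: iso_def bij_betw_def)
  let ?U = "{x \<in> carrier G. \<phi> x \<in> V}"
  have U: "subgroup ?U G" by (rule G.subgroupI) auto
  have "openin T ?U"
    using openin_continuous_map_preimage[OF homeomorphic_imp_continuous_map[OF \<phi>(2)]] V G(2) by simp
  then have fin: "finite {(?U #>\<^bsub>G\<^esub> x) <#>\<^bsub>G\<^esub> ?U | x. x \<in> carrier G}"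
    using rp U by (simp add: roelcke_precompact_def)
  have "(V #>\<^bsub>H\<^esub> \<phi> x) <#>\<^bsub>H\<^esub> V = \<phi> ` ((?U #>\<^bsub>G\<^esub> x) <#>\<^bsub>G\<^esub> ?U)" if x: "x \<in> carrier G" for x
    unfolding double_coset_eq
  proof (intro Set.set_eqI iffI)
    fix z assume "z \<in> {a \<otimes>\<^bsub>H\<^esub> \<phi> x \<otimes>\<^bsub>H\<^esub> b |a b. a \<in> V \<and> b \<in> V}"
    then obtain a b where ab: "a \<in> V" "b \<in> V" "z = a \<otimes>\<^bsub>H\<^esub> \<phi> x \<otimes>\<^bsub>H\<^esub> b" by blast
    then have "a \<in> \<phi> ` carrier G" "b \<in> \<phi> ` carrier G" using surj by simp_all
    then obtain a' b' where a'b': "a' \<in> carrier G" "a = \<phi> a'" "b' \<in> carrier G" "b = \<phi> b'" by blast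
    then have "z = \<phi> (a' \<otimes>\<^bsub>G\<^esub> x \<otimes>\<^bsub>G\<^esub> b')" using ab x by simp
    then show "z \<in> \<phi> ` {a \<otimes>\<^bsub>G\<^esub> x \<otimes>\<^bsub>G\<^esub> b |a b. a \<in> ?U \<and> b \<in> ?U}" using a'b' ab by blast
  next
    fix z assume "z \<in> \<phi> ` {a \<otimes>\<^bsub>G\<^esub> x \<otimes>\<^bsub>G\<^esub> b |a b. a \<in> ?U \<and> b \<in> ?U}"
    then obtain a b where "a \<in> ?U" "b \<in> ?U" "z = \<phi> (a \<otimes>\<^bsub>G\<^esub> x \<otimes>\<^bsub>G\<^esub> b)" by blast
    moreover from this have "z = \<phi> a \<otimes>\<^bsub>H\<^esub> \<phi> x \<otimes>\<^bsub>H\<^esub> \<phi> b" using x by simp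
    ultimately show "z \<in> {a \<otimes>\<^bsub>H\<^esub> \<phi> x \<otimes>\<^bsub>H\<^esub> b |a b. a \<in> V \<and> b \<in> V}" by blast
  qed
  then have "{(V #>\<^bsub>H\<^esub> y) <#>\<^bsub>H\<^esub> V |y. y \<in> carrier H} =
      (`) \<phi> ` {(?U #>\<^bsub>G\<^esub> x) <#>\<^bsub>G\<^esub> ?U | x. x \<in> carrier G}"
    unfolding surj[symmetric] by auto
  then show "finite {(V #>\<^bsub>H\<^esub> y) <#>\<^bsub>H\<^esub> V |y. y \<in> carrier H}" using fin by simp
qed

text \<open>The double coset of \<open>x\<close> modulo the stabilizer of a finite tuple \<open>a\<close> is determined by the
  type of the pair \<open>(a, x a)\<close>.\<close>

lemma (in omega_categorical_struct) roelcke_precompact_Aut: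
  "roelcke_precompact (Aut \<L> M) (Aut_topology \<L> M)"
  unfolding roelcke_precompact_def
proof (intro allI impI)
  let ?G = "Aut \<L> M"
  fix V assume V: "subgroup V ?G \<and> openin (Aut_topology \<L> M) V"
  interpret group ?G by (rule group_Aut[OF struct])
  interpret V: subgroup V ?G using V by simp
  obtain F where F: "finite F" "F \<subseteq> universe M" "stabilizer \<L> M F \<subseteq> V"
    using stabilizer_neighbourhood_basis[of \<L> M V] V V.one_closed by blast
  obtain as where as: "set as = F" using finite_list[OF F(1)] by blast
  obtain d where d: "d \<in> universe M" using struct by (auto simp: is_struct_def)
  define n where "n = length as"
  \<comment> \<open>The assignment lists the tuple, then its image under \<open>x\<close>; the
    default \<open>d\<close> fills the remaining variables.\<close>
  define ev where "ev x i = (if i < n then as ! i else if i < 2 * n then x (as ! (i - n)) else d)"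
    for x :: "'a \<Rightarrow> 'a" and i
  have as_in: "as ! i \<in> universe M" if "i < n" for i using that as F(2) by (auto simp: n_def)
  have ev: "env (ev x)" if x: "x \<in> carrier ?G" for x
    using as_in d Aut_closed[OF x] by (auto simp: env_def ev_def)
  obtain T where T: "finite T" "\<And>\<theta>. \<theta> \<in> T \<Longrightarrow> complete (2 * n) \<theta>"
      "\<And>e. env e \<Longrightarrow> \<exists>\<theta>\<in>T. sat M e \<theta>"
    using finitely_many_complete[of "2 * n"] by blast
  obtain t where t: "\<And>x. x \<in> carrier ?G \<Longrightarrow> t x \<in> T \<and> sat M (ev x) (t x)"
    using T(3)[OF ev] by metis
  have "(V #>\<^bsub>?G\<^esub> x) <#>\<^bsub>?G\<^esub> V = (V #>\<^bsub>?G\<^esub> y) <#>\<^bsub>?G\<^esub> V"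
    if x: "x \<in> carrier ?G" and y: "y \<in> carrier ?G" and eq: "t x = t y" for x y
  proof -
    obtain g0 where g0: "isomorphism \<L> M M g0" "\<And>i. i < 2 * n \<Longrightarrow> g0 (ev x i) = ev y i"
      using same_type_automorphism[OF ev[OF x] ev[OF y], of "2 * n" "t x"] t[OF x] t[OF y] T(2) eq
      by metis
    define g where "g = restrict g0 (universe M)"
    have g: "g \<in> carrier ?G" unfolding g_def by (rule restrict_isomorphism_Aut[OF struct g0(1)])
    have ga: "g a = a \<and> g (x a) = y a" if "a \<in> F" for a
    proof -
      have "a \<in> set as" using that as by simp
      then obtain i where i: "i < n" "as ! i = a" by (auto simp: n_def in_set_conv_nth)
      have "a \<in> universe M" "x a \<in> universe M" using that F(2) Aut_closed[OF x] by auto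
      then show ?thesis using g0(2)[of i] g0(2)[of "n + i"] i by (simp add: ev_def g_def)
    qed
    \<comment> \<open>Since \<open>g\<close> carries \<open>x a\<close> to \<open>y a\<close>, the
      element \<open>inv y \<otimes> g \<otimes> x\<close> fixes the tuple. Both it and
      \<open>g\<close> thus lie in \<open>V\<close>, and \<open>x\<close> is
      \<open>inv g \<otimes> y\<close> times this element.\<close>
    let ?v = "inv\<^bsub>?G\<^esub> y \<otimes>\<^bsub>?G\<^esub> (g \<otimes>\<^bsub>?G\<^esub> x)"
    have "g \<in> stabilizer \<L> M F" using g ga by (simp add: stabilizer_def)
    then have gV: "g \<in> V" using F(3) by blast
    have "?v a = a" if "a \<in> F" for a
    proof -
      have a: "a \<in> universe M" using that F(2) by blast
      have "?v a = (inv\<^bsub>?G\<^esub> y) (g (x a))"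
        using a x y g by (simp add: mult_Aut_apply)
      also have "\<dots> = (inv\<^bsub>?G\<^esub> y \<otimes>\<^bsub>?G\<^esub> y) a"
        by (simp only: mult_Aut_apply[OF inv_closed[OF y] y a] ga[OF that])
      also have "\<dots> = a" using a by (simp only: l_inv[OF y] one_Aut restrict_apply')
      finally show ?thesis .
    qed
    then have "?v \<in> stabilizer \<L> M F" using x y g by (simp add: stabilizer_def)
    then have vV: "?v \<in> V" using F(3) by blast
    have "inv\<^bsub>?G\<^esub> g \<otimes>\<^bsub>?G\<^esub> y \<otimes>\<^bsub>?G\<^esub> ?v = inv\<^bsub>?G\<^esub> g \<otimes>\<^bsub>?G\<^esub> (y \<otimes>\<^bsub>?G\<^esub> inv\<^bsub>?G\<^esub> y) \<otimes>\<^bsub>?G\<^esub> g \<otimes>\<^bsub>?G\<^esub> x"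
      using x y g by (simp only: m_assoc m_closed inv_closed)
    also have "\<dots> = x" using x y g by (simp del: one_Aut)
    finally have "x = inv\<^bsub>?G\<^esub> g \<otimes>\<^bsub>?G\<^esub> y \<otimes>\<^bsub>?G\<^esub> ?v" ..
    then show ?thesis using double_coset_cong[OF V.subgroup_axioms y, of "inv\<^bsub>?G\<^esub> g" ?v] gV vV by simp
  qed
  moreover have "finite (t ` carrier ?G)" using t by (intro finite_subset[OF _ T(1)]) auto
  ultimately have "finite ((\<lambda>x. (V #>\<^bsub>?G\<^esub> x) <#>\<^bsub>?G\<^esub> V) ` carrier ?G)"
    by (rule finite_image_factor[rotated])
  then show "finite {(V #>\<^bsub>?G\<^esub> x) <#>\<^bsub>?G\<^esub> V |x. x \<in> carrier ?G}"
    by (simp add: setcompr_eq_image)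
qed

section \<open>Generated substructures and double cosets\<close>

text \<open>A hull is an intersection and would be the whole type if no closed set contained
  \<open>S\<close>. The universe is such a closed set, because the structure is closed under its
  functions.\<close>

lemma closed_subset_hull:
  assumes "is_struct \<L> M" "S \<subseteq> universe M"
  shows "closed_subset \<L> M (closed_subset \<L> M hull S)"
proof -
  have "closed_subset \<L> M (universe M)"
    using assms(1) by (auto simp: closed_subset_def is_struct_def arguments_def)
  then have "closed_subset \<L> M hull S \<subseteq> universe M" using assms(2) by (rule hull_minimal[rotated])
  then show ?thesis unfolding closed_subset_def hull_def by blast
qed

lemma isomorphism_image_hull_subset:
  assumes M: "is_struct \<L> M" and g: "isomorphism \<L> M M g" and S: "S \<subseteq> universe M"
  shows "g ` (closed_subset \<L> M hull S) \<subseteq> closed_subset \<L> M hull (g ` S)"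
proof -
  let ?C = "closed_subset \<L> M hull (g ` S)"
  have "g ` S \<subseteq> universe M" using g S by (auto simp: isomorphism_def bij_betw_def)
  then have C: "closed_subset \<L> M ?C" by (rule closed_subset_hull[OF M])
  let ?D = "{x \<in> universe M. g x \<in> ?C}"
  have "interp_fun M f xs \<in> ?D"
    if f: "f \<in> funs \<L>" and xs: "set xs \<subseteq> ?D" "length xs = farity \<L> f" for f xs
  proof -
    have a: "xs \<in> arguments M (farity \<L> f)" using xs by (auto simp: arguments_def)
    then have "g (interp_fun M f xs) = interp_fun M f (map g xs)"
      using g f by (auto simp: isomorphism_def)
    moreover have "set (map g xs) \<subseteq> ?C" using xs by auto
    then have "interp_fun M f (map g xs) \<in> ?C"
      using C f xs unfolding closed_subset_def by simp
    moreover have "interp_fun M f xs \<in> universe M" using M f a by (auto simp: is_struct_def)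
    ultimately show ?thesis by simp
  qed
  then have "closed_subset \<L> M ?D" unfolding closed_subset_def by blast
  moreover have "S \<subseteq> {x \<in> universe M. g x \<in> ?C}" using S hull_subset[of "g ` S"] by blast
  ultimately have "closed_subset \<L> M hull S \<subseteq> {x \<in> universe M. g x \<in> ?C}" by (rule hull_minimal[rotated])
  then show ?thesis by blast
qed

lemma card_isomorphism_hull:
  assumes M: "is_struct \<L> M" and g: "isomorphism \<L> M M g" and S: "S \<subseteq> universe M"
  shows "card (closed_subset \<L> M hull (g ` S)) = card (closed_subset \<L> M hull S)"
proof -
  have b: "bij_betw g (universe M) (universe M)" using g by (simp add: isomorphism_def)
  let ?k = "inv_into (universe M) g"
  have gS: "g ` S \<subseteq> universe M" using b S by (auto simp: bij_betw_def)
  have sub: "closed_subset \<L> M hull S \<subseteq> universe M" "closed_subset \<L> M hull (g ` S) \<subseteq> universe M"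
    using closed_subset_hull[OF M S] closed_subset_hull[OF M gS] unfolding closed_subset_def by blast+
  have "?k ` g ` S = S" using b S by (intro inv_into_image_cancel) (auto simp: bij_betw_def)
  then have "?k ` (closed_subset \<L> M hull (g ` S)) \<subseteq> closed_subset \<L> M hull S"
    using isomorphism_image_hull_subset[OF M isomorphism_inv_into[OF M g] gS] by simp
  then have "g ` ?k ` (closed_subset \<L> M hull (g ` S)) \<subseteq> g ` (closed_subset \<L> M hull S)"
    by (rule image_mono)
  moreover have "g ` ?k ` (closed_subset \<L> M hull (g ` S)) = closed_subset \<L> M hull (g ` S)"
    using b sub(2) by (intro image_inv_into_cancel) (auto simp: bij_betw_def)
  ultimately have "closed_subset \<L> M hull (g ` S) = g ` (closed_subset \<L> M hull S)"
    using isomorphism_image_hull_subset[OF M g S] by simp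
  then show ?thesis
    using b sub(1) by (metis bij_betw_def card_image inj_on_subset)
qed

text \<open>The size of the substructure generated by \<open>a\<close> and \<open>x a\<close> only depends on the double coset
  of \<open>x\<close> modulo the stabilizer of \<open>a\<close>.\<close>

lemma not_roelcke_precompact_Aut:
  assumes M: "is_struct \<L> M" and a: "a \<in> universe M"
    and large: "\<And>n. \<exists>x\<in>carrier (Aut \<L> M). card (closed_subset \<L> M hull {a, x a}) \<ge> n"
  shows "\<not> roelcke_precompact (Aut \<L> M) (Aut_topology \<L> M)"
proof
  let ?G = "Aut \<L> M" and ?V = "stabilizer \<L> M {a}"
  assume "roelcke_precompact ?G (Aut_topology \<L> M)"
  moreover have V: "subgroup ?V ?G" using a by (intro subgroup_stabilizer M) simp
  moreover have "openin (Aut_topology \<L> M) ?V" using a by (intro openin_stabilizer) simp_all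
  ultimately have fin: "finite {(?V #>\<^bsub>?G\<^esub> x) <#>\<^bsub>?G\<^esub> ?V | x. x \<in> carrier ?G}"
    by (simp add: roelcke_precompact_def)
  interpret group ?G by (rule group_Aut[OF M])
  interpret V: subgroup ?V ?G by (rule V)
  \<comment> \<open>Instead of isomorphism types a number is attached to each \<open>x\<close>: as
    it is constant on double cosets, finitely many of these would bound it.\<close>
  define s where "s x = card (closed_subset \<L> M hull {a, x a})" for x
  have "s x = s y" if x: "x \<in> carrier ?G" and y: "y \<in> carrier ?G"
    and eq: "(?V #>\<^bsub>?G\<^esub> x) <#>\<^bsub>?G\<^esub> ?V = (?V #>\<^bsub>?G\<^esub> y) <#>\<^bsub>?G\<^esub> ?V" for x y
  proof -
    have "x = \<one>\<^bsub>?G\<^esub> \<otimes>\<^bsub>?G\<^esub> x \<otimes>\<^bsub>?G\<^esub> \<one>\<^bsub>?G\<^esub>" using x by (simp del: one_Aut)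
    then have "x \<in> (?V #>\<^bsub>?G\<^esub> x) <#>\<^bsub>?G\<^esub> ?V" unfolding double_coset_eq using V.one_closed by blast
    then have "x \<in> {u \<otimes>\<^bsub>?G\<^esub> y \<otimes>\<^bsub>?G\<^esub> v |u v. u \<in> ?V \<and> v \<in> ?V}"
      by (simp only: eq) (simp only: double_coset_eq)
    then obtain u v where u: "u \<in> ?V" and v: "v \<in> ?V" and xe: "x = u \<otimes>\<^bsub>?G\<^esub> y \<otimes>\<^bsub>?G\<^esub> v"
      by blast
    have c: "u \<in> carrier ?G" "v \<in> carrier ?G"
      by (rule V.mem_carrier[OF u], rule V.mem_carrier[OF v])
    have ua: "u a = a" and va: "v a = a" using u v unfolding stabilizer_def by blast+
    have "x a = u (y a)"
      unfolding xe using mult_Aut_apply[OF m_closed[OF c(1) y] c(2) a] mult_Aut_apply[OF c(1) y a] va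
      by (simp only:)
    then have "{a, x a} = u ` {a, y a}" by (simp add: ua)
    then show "s x = s y"
      unfolding s_def using card_isomorphism_hull[OF M, of u "{a, y a}"] c(1) a Aut_closed[OF y a]
      by (simp add: carrier_Aut)
  qed
  moreover have "finite ((\<lambda>x. (?V #>\<^bsub>?G\<^esub> x) <#>\<^bsub>?G\<^esub> ?V) ` carrier ?G)"
    using fin by (simp add: setcompr_eq_image)
  ultimately have "finite (s ` carrier ?G)" by (rule finite_image_factor[rotated])
  then obtain n where "\<forall>m\<in>s ` carrier ?G. m < n" by (meson finite_nat_set_iff_bounded)
  then show False using large[of n] unfolding s_def by (meson image_eqI leD)
qed

section \<open>Heyting algebras\<close>

text \<open>The symbols are grouped by arity, which reduces conditions on argument lists to
  constants and binary operations.\<close>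

lemma heyting_symbol_cases:
  "(\<forall>s. P s) \<longleftrightarrow> (\<forall>s\<in>{Zero, One}. P s) \<and> (\<forall>s\<in>{Meet, Join, Arrow}. P s)"
  by (auto intro: heyting_symbol.induct)

lemma list_length_2: "length xs = 2 \<longleftrightarrow> (\<exists>x y. xs = [x, y])"
  by (auto simp: length_Suc_conv numeral_2_eq_2)

lemma heyting_language_simps [simp]:
  "funs heyting_language = UNIV" "rels heyting_language = {}"
  "s \<in> {Zero, One} \<Longrightarrow> farity heyting_language s = 0"
  "s \<in> {Meet, Join, Arrow} \<Longrightarrow> farity heyting_language s = 2"
  by (auto simp: heyting_language_def)

lemma is_struct_heyting:
  "is_struct heyting_language M \<longleftrightarrow> universe M \<noteq> {} \<and>
    (\<forall>s\<in>{Zero, One}. interp_fun M s [] \<in> universe M) \<and>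
    (\<forall>s\<in>{Meet, Join, Arrow}. \<forall>x\<in>universe M. \<forall>y\<in>universe M. interp_fun M s [x, y] \<in> universe M)"
  unfolding is_struct_def heyting_language_simps(1) ball_UNIV heyting_symbol_cases
  by (auto simp: arguments_def heyting_language_def list_length_2)

lemma closed_subset_heyting:
  "closed_subset heyting_language M A \<longleftrightarrow> A \<subseteq> universe M \<and>
    (\<forall>s\<in>{Zero, One}. interp_fun M s [] \<in> A) \<and>
    (\<forall>s\<in>{Meet, Join, Arrow}. \<forall>x\<in>A. \<forall>y\<in>A. interp_fun M s [x, y] \<in> A)"
  unfolding closed_subset_def heyting_language_simps(1) ball_UNIV heyting_symbol_cases
  by (auto simp: heyting_language_def list_length_2)

lemma isomorphism_heyting:
  "isomorphism heyting_language M N h \<longleftrightarrow> bij_betw h (universe M) (universe N) \<and>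
    (\<forall>s\<in>{Zero, One}. h (interp_fun M s []) = interp_fun N s []) \<and>
    (\<forall>s\<in>{Meet, Join, Arrow}. \<forall>x\<in>universe M. \<forall>y\<in>universe M.
      h (interp_fun M s [x, y]) = interp_fun N s [h x, h y])"
  unfolding isomorphism_def heyting_language_simps(1) ball_UNIV heyting_symbol_cases
  by (auto simp: heyting_language_def list_length_2 arguments_def)

definition dense_element :: "(heyting_symbol, unit, 'a) struct \<Rightarrow> 'a \<Rightarrow> bool"
  where "dense_element H a \<longleftrightarrow> a \<in> universe H \<and> a \<noteq> interp_fun H Zero [] \<and> a \<noteq> interp_fun H One [] \<and>
    interp_fun H Arrow [a, interp_fun H Zero []] = interp_fun H Zero []"

locale heyting =
  fixes H :: "(heyting_symbol, unit, 'a) struct"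
  assumes heyting: "heyting_algebra H"
begin

abbreviation "U \<equiv> universe H"
definition "hzero = interp_fun H Zero []"
definition "hone = interp_fun H One []"
definition "hmeet x y = interp_fun H Meet [x, y]"
definition "hjoin x y = interp_fun H Join [x, y]"
definition "harrow x y = interp_fun H Arrow [x, y]"

lemma struct: "is_struct heyting_language H"
  using heyting by (simp add: heyting_algebra_def)

lemma closed:
  "hzero \<in> U" "hone \<in> U"
  "x \<in> U \<Longrightarrow> y \<in> U \<Longrightarrow> hmeet x y \<in> U"
  "x \<in> U \<Longrightarrow> y \<in> U \<Longrightarrow> hjoin x y \<in> U"
  "x \<in> U \<Longrightarrow> y \<in> U \<Longrightarrow> harrow x y \<in> U"
  using struct by (simp_all add: is_struct_heyting hzero_def hone_def hmeet_def hjoin_def harrow_def)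

lemma laws:
  assumes "x \<in> U" "y \<in> U"
  shows "hmeet x y = hmeet y x" "hjoin x y = hjoin y x" "hmeet x (hjoin x y) = x" "hjoin x (hmeet x y) = x"
    "hmeet hzero x = hzero" "hmeet x hone = x"
    "z \<in> U \<Longrightarrow> hmeet (hmeet z x) y = hmeet z x \<longleftrightarrow> hmeet z (harrow x y) = z"
proof -
  have *: "hmeet x y = hmeet y x \<and> hjoin x y = hjoin y x \<and> hmeet x (hjoin x y) = x \<and>
      hjoin x (hmeet x y) = x \<and> hmeet hzero x = hzero \<and> hmeet x hone = x \<and>
      (hmeet (hmeet z x) y = hmeet z x \<longleftrightarrow> hmeet z (harrow x y) = z)" if "z \<in> U" for z
    using heyting assms that
    unfolding heyting_algebra_def Let_def hzero_def hone_def hmeet_def hjoin_def harrow_def by blast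
  show "hmeet x y = hmeet y x" "hjoin x y = hjoin y x" "hmeet x (hjoin x y) = x"
    "hjoin x (hmeet x y) = x" "hmeet hzero x = hzero" "hmeet x hone = x"
    using *[OF assms(1)] by blast+
  show "z \<in> U \<Longrightarrow> hmeet (hmeet z x) y = hmeet z x \<longleftrightarrow> hmeet z (harrow x y) = z"
    using * by blast
qed

lemma meet_assoc:
  "x \<in> U \<Longrightarrow> y \<in> U \<Longrightarrow> z \<in> U \<Longrightarrow> hmeet (hmeet x y) z = hmeet x (hmeet y z)"
  using heyting unfolding heyting_algebra_def Let_def hmeet_def by blast

lemma meet_idem: "x \<in> U \<Longrightarrow> hmeet x x = x"
  using laws(3,4)[of x x] laws(3)[of x "hmeet x x"] closed by metis

text \<open>An element is determined by the set of elements below it, and the adjunction prescribes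
  this set for an implication.\<close>

lemma arrow_eq:
  assumes "x \<in> U" "y \<in> U" "w \<in> U"
    and "\<And>z. z \<in> U \<Longrightarrow> hmeet (hmeet z x) y = hmeet z x \<longleftrightarrow> hmeet z w = z"
  shows "harrow x y = w"
proof -
  have e: "hmeet z (harrow x y) = z \<longleftrightarrow> hmeet z w = z" if "z \<in> U" for z
    using laws(7)[OF assms(1,2) that] assms(4)[OF that] by simp
  have c: "harrow x y \<in> U" using assms(1,2) by (rule closed(5))
  have "hmeet (harrow x y) w = harrow x y" "hmeet w (harrow x y) = w"
    using e[OF c] e[OF assms(3)] meet_idem[OF c] meet_idem[OF assms(3)] by simp_all
  then show ?thesis using laws(1)[OF c assms(3)] by simp
qed

text \<open>For a dense \<open>a\<close> these laws and \<open>harrow a hzero = hzero\<close> make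
  up the full operation tables on 0, a, 1. Hence the tables do not depend on
  \<open>a\<close>.\<close>

lemma bound_laws:
  assumes x: "x \<in> U"
  shows "hmeet hzero x = hzero" "hmeet x hzero = hzero" "hmeet hone x = x" "hmeet x hone = x" "hmeet x x = x"
    "hjoin hzero x = x" "hjoin x hzero = x" "hjoin hone x = hone" "hjoin x hone = hone" "hjoin x x = x"
    "harrow hzero x = hone" "harrow x hone = hone" "harrow hone x = x" "harrow x x = hone"
proof -
  note c = closed(1,2)
  show m: "hmeet hzero x = hzero" "hmeet x hone = x" "hmeet x hzero = hzero" "hmeet hone x = x"
    using laws(1,5,6) x c by metis+
  show "hmeet x x = x" using meet_idem x .
  show "hjoin x x = x" using laws(4)[of x x] meet_idem x by simp
  show "hjoin x hzero = x" "hjoin hzero x = x" using laws(4)[of x hzero] laws(2)[of hzero x] m x c by simp_all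
  show "hjoin hone x = hone" "hjoin x hone = hone" using laws(4)[of hone x] laws(2)[of hone x] m x c by simp_all
  show "harrow x hone = hone"
    using laws(6)[OF closed(3)[OF _ x]] laws(6) x c closed(3) by (intro arrow_eq) auto
  show "harrow hone x = x"
    using laws(6) x c by (intro arrow_eq) auto
  have m': "hmeet (hmeet z x) x = hmeet z x" if "z \<in> U" for z
    using meet_assoc[OF that x x] meet_idem[OF x] by simp
  show "harrow x x = hone" using m' laws(6) x c by (intro arrow_eq) auto
  show "harrow hzero x = hone"
    using laws(1,5,6) x c by (intro arrow_eq) (metis)+
qed

lemma dense_chain:
  assumes "dense_element H a"
  shows "closed_subset heyting_language H hull {a} = {hzero, a, hone}"
proof (rule hull_unique)
  have a: "a \<in> U" "a \<noteq> hzero" "a \<noteq> hone" "harrow a hzero = hzero"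
    using assms by (simp_all add: dense_element_def hzero_def hone_def harrow_def)
  show "closed_subset heyting_language H {hzero, a, hone}"
    using a closed(1,2) bound_laws[OF a(1)] bound_laws[OF closed(1)] bound_laws[OF closed(2)]
    unfolding closed_subset_heyting
    by (simp flip: hzero_def hone_def hmeet_def hjoin_def harrow_def)
  fix A assume "{a} \<subseteq> A" "closed_subset heyting_language H A"
  then show "{hzero, a, hone} \<subseteq> A" by (auto simp: closed_subset_heyting hzero_def hone_def)
qed simp

lemma dense_isomorphism:
  assumes a: "dense_element H a" and b: "dense_element H b"
  obtains h where "isomorphism heyting_language
      (H\<lparr>universe := closed_subset heyting_language H hull {a}\<rparr>)
      (H\<lparr>universe := closed_subset heyting_language H hull {b}\<rparr>) h" "h a = b"
proof
  have a': "a \<in> U" "a \<noteq> hzero" "a \<noteq> hone" "harrow a hzero = hzero"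
    using a by (simp_all add: dense_element_def hzero_def hone_def harrow_def)
  have b': "b \<in> U" "b \<noteq> hzero" "b \<noteq> hone" "harrow b hzero = hzero"
    using b by (simp_all add: dense_element_def hzero_def hone_def harrow_def)
  let ?h = "id(a := b)"
  have "bij_betw ?h {hzero, a, hone} {hzero, b, hone}"
    using a' b' by (auto simp: bij_betw_def inj_on_def)
  then show "isomorphism heyting_language
      (H\<lparr>universe := closed_subset heyting_language H hull {a}\<rparr>)
      (H\<lparr>universe := closed_subset heyting_language H hull {b}\<rparr>) ?h"
    using a' b' closed(1,2)
      bound_laws[OF a'(1)] bound_laws[OF b'(1)] bound_laws[OF closed(1)] bound_laws[OF closed(2)]
    unfolding isomorphism_heyting dense_chain[OF a] dense_chain[OF b]
    by (simp flip: hzero_def hone_def hmeet_def hjoin_def harrow_def)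
qed simp

end

lemma dense_conjugate:
  assumes L: "heyting_algebra L" "ultrahomogeneous heyting_language L"
    and a: "dense_element L a" and b: "dense_element L b"
  shows "\<exists>g\<in>carrier (Aut heyting_language L). g a = b"
proof -
  interpret heyting L by unfold_locales (rule L(1))
  have ab: "a \<in> universe L" "b \<in> universe L" using a b by (simp_all add: dense_element_def)
  obtain h where h: "isomorphism heyting_language
      (L\<lparr>universe := closed_subset heyting_language L hull {a}\<rparr>)
      (L\<lparr>universe := closed_subset heyting_language L hull {b}\<rparr>) h" "h a = b"
    using dense_isomorphism[OF a b] by blast
  have fg: "fg_substruct heyting_language L (L\<lparr>universe := closed_subset heyting_language L hull {c}\<rparr>)"
    if "c \<in> universe L" for c
    using that unfolding fg_substruct_def by (intro exI[of _ "{c}"]) simp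
  have "\<exists>g. isomorphism heyting_language L L g \<and>
      (\<forall>x\<in>universe (L\<lparr>universe := closed_subset heyting_language L hull {a}\<rparr>). g x = h x)"
    using L(2) fg[OF ab(1)] fg[OF ab(2)] h(1) unfolding ultrahomogeneous_def by blast
  then obtain g where g: "isomorphism heyting_language L L g"
      "\<forall>x\<in>closed_subset heyting_language L hull {a}. g x = h x"
    by auto
  have "g a = b" using g(2) h(2) by (simp add: hull_inc)
  then show ?thesis
    using restrict_isomorphism_Aut[OF struct g(1)] ab(1) by (metis restrict_apply')
qed

section \<open>A dense pair generating many elements\<close>

definition upset :: "(nat \<Rightarrow> nat \<Rightarrow> bool) \<Rightarrow> nat set \<Rightarrow> nat set \<Rightarrow> bool"
  where "upset R W A \<longleftrightarrow> A \<subseteq> W \<and> (\<forall>i\<in>A. \<forall>j\<in>W. R i j \<longrightarrow> j \<in> A)"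

definition upset_imp :: "(nat \<Rightarrow> nat \<Rightarrow> bool) \<Rightarrow> nat set \<Rightarrow> nat set \<Rightarrow> nat set \<Rightarrow> nat set"
  where "upset_imp R W A B = {w \<in> W. \<forall>j\<in>W. R w j \<and> j \<in> A \<longrightarrow> j \<in> B}"

text \<open>This is the Heyting algebra of truth sets of a Kripke frame, with
  \<open>upset_imp\<close> as intuitionistic implication. Finite sets are coded by numbers since the
  members of the class, and so of an age, are structures on \<open>nat\<close>.\<close>

definition upset_algebra :: "(nat \<Rightarrow> nat \<Rightarrow> bool) \<Rightarrow> nat set \<Rightarrow> (heyting_symbol, unit, nat) struct"
  where "upset_algebra R W = \<lparr>universe = set_encode ` {A. upset R W A},
    interp_fun = (\<lambda>s xs. let A = set_decode (xs ! 0); B = set_decode (xs ! 1) in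
      set_encode (case s of Zero \<Rightarrow> {} | One \<Rightarrow> W | Meet \<Rightarrow> A \<inter> B | Join \<Rightarrow> A \<union> B
        | Arrow \<Rightarrow> upset_imp R W A B)),
    interp_rel = (\<lambda>_ _. False)\<rparr>"

locale finite_preorder =
  fixes R :: "nat \<Rightarrow> nat \<Rightarrow> bool" and W :: "nat set"
  assumes finite_W: "finite W" and refl: "\<And>i. R i i" and trans: "\<And>i j k. R i j \<Longrightarrow> R j k \<Longrightarrow> R i k"
begin

abbreviation "K \<equiv> upset_algebra R W"

lemma finite_upset: "upset R W A \<Longrightarrow> finite A"
  using finite_W by (auto simp: upset_def intro: finite_subset)

lemma universe_upset: "x \<in> universe K \<longleftrightarrow> (\<exists>A. upset R W A \<and> x = set_encode A)"
  by (auto simp: upset_algebra_def)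

lemma finite_universe: "finite (universe K)"
proof -
  have "{A. upset R W A} \<subseteq> Pow W" by (auto simp: upset_def)
  then show ?thesis using finite_W by (auto simp: upset_algebra_def intro: finite_subset)
qed

lemma upset_closed:
  "upset R W {}" "upset R W W"
  "upset R W A \<Longrightarrow> upset R W B \<Longrightarrow> upset R W (A \<inter> B)"
  "upset R W A \<Longrightarrow> upset R W B \<Longrightarrow> upset R W (A \<union> B)"
  "upset R W (upset_imp R W A B)"
  using trans by (auto simp: upset_def upset_imp_def)

lemma encode_eq: "upset R W A \<Longrightarrow> upset R W B \<Longrightarrow> set_encode A = set_encode B \<longleftrightarrow> A = B"
  by (simp add: finite_upset set_encode_eq)

lemma interp_upset:
  "interp_fun K Zero [] = set_encode {}" "interp_fun K One [] = set_encode W"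
  "upset R W A \<Longrightarrow> upset R W B \<Longrightarrow> interp_fun K Meet [set_encode A, set_encode B] = set_encode (A \<inter> B)"
  "upset R W A \<Longrightarrow> upset R W B \<Longrightarrow> interp_fun K Join [set_encode A, set_encode B] = set_encode (A \<union> B)"
  "upset R W A \<Longrightarrow> upset R W B \<Longrightarrow>
    interp_fun K Arrow [set_encode A, set_encode B] = set_encode (upset_imp R W A B)"
  by (simp_all add: upset_algebra_def Let_def finite_upset)

text \<open>From left to right, whatever a world of \<open>C\<close> sees is again in
  \<open>C\<close>. From right to left, a world sees itself.\<close>

lemma upset_adjunction:
  assumes "upset R W C"
  shows "C \<inter> A \<inter> B = C \<inter> A \<longleftrightarrow> C \<inter> upset_imp R W A B = C"
  using assms refl by (auto simp: upset_def upset_imp_def) blast+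

lemma heyting_algebra_upset: "heyting_algebra K"
  unfolding heyting_algebra_def Let_def
proof (rule conjI)
  show "is_struct heyting_language K"
  proof -
    have e: "set_encode A \<in> universe K" if "upset R W A" for A
      using that by (auto simp: universe_upset)
    then have "universe K \<noteq> {}" using upset_closed(1) by blast
    then show ?thesis
      unfolding is_struct_heyting using e upset_closed
      by (auto simp: interp_upset simp del: set_encode_empty dest!: universe_upset[THEN iffD1])
  qed
next
  show "\<forall>x\<in>universe K. \<forall>y\<in>universe K. \<forall>z\<in>universe K.
    interp_fun K Meet [interp_fun K Meet [x, y], z] = interp_fun K Meet [x, interp_fun K Meet [y, z]] \<and>
    interp_fun K Join [interp_fun K Join [x, y], z] = interp_fun K Join [x, interp_fun K Join [y, z]] \<and>
    interp_fun K Meet [x, y] = interp_fun K Meet [y, x] \<and>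
    interp_fun K Join [x, y] = interp_fun K Join [y, x] \<and>
    interp_fun K Meet [x, interp_fun K Join [x, y]] = x \<and>
    interp_fun K Join [x, interp_fun K Meet [x, y]] = x \<and>
    interp_fun K Meet [interp_fun K Zero [], x] = interp_fun K Zero [] \<and>
    interp_fun K Meet [x, interp_fun K One []] = x \<and>
    (interp_fun K Meet [interp_fun K Meet [z, x], y] = interp_fun K Meet [z, x]) =
      (interp_fun K Meet [z, interp_fun K Arrow [x, y]] = z)"
    (is "\<forall>x\<in>_. \<forall>y\<in>_. \<forall>z\<in>_. ?P x y z")
  proof (intro ballI)
    fix x y z assume "x \<in> universe K" "y \<in> universe K" "z \<in> universe K"
    then obtain A B C where u: "upset R W A" "upset R W B" "upset R W C"
      and e: "x = set_encode A" "y = set_encode B" "z = set_encode C"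
      unfolding universe_upset by blast
    have "{} \<inter> A = {}" "A \<inter> W = A" "A \<inter> (A \<union> B) = A" "A \<union> A \<inter> B = A"
      using u(1) by (auto simp: upset_def)
    moreover note upset_adjunction[OF u(3), of A B]
    ultimately show "?P x y z"
      unfolding e using u
      by (simp add: interp_upset upset_closed encode_eq Int_ac Un_ac del: set_encode_empty)
  qed
qed

end

text \<open>The Rieger--Nishimura ladder: the world \<open>k + 1\<close> is the \<open>k\<close>-th world of the ladder, and the
  additional world 0 is seen by every other one, which makes every nonempty upset dense.\<close>

definition sees :: "nat \<Rightarrow> nat \<Rightarrow> bool"
  where "sees i j \<longleftrightarrow> j = 0 \<or> j = i \<or> j + 2 \<le> i"

lemma finite_preorder_sees: "finite_preorder sees {..n}"
  by unfold_locales (auto simp: sees_def)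

lemma upset_cone: "k \<le> n \<Longrightarrow> upset sees {..n} {j. sees k j}"
  by (auto simp: upset_def sees_def)

text \<open>For \<open>k = 1, 2, 3\<close>, truncated subtraction replaces the missing cones by that of 0.\<close>

lemma upset_imp_cone:
  assumes "Suc k \<le> n" "k \<noteq> 0"
  shows "upset_imp sees {..n} {j. sees k j} ({j. sees (k - 2) j} \<union> {j. sees (k - 3) j}) = {j. sees (Suc k) j}"
proof (intro Set.set_eqI iffI)
  fix w assume w: "w \<in> upset_imp sees {..n} {j. sees k j} ({j. sees (k - 2) j} \<union> {j. sees (k - 3) j})"
  \<comment> \<open>World \<open>k\<close> lies in its own cone but in neither of the smaller ones,
    so \<open>w\<close> cannot see \<open>k\<close>. The worlds that do not see \<open>k\<close> are
    those below \<open>k\<close> together with \<open>k + 1\<close>, and these form the cone of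
    \<open>k + 1\<close>.\<close>
  have "\<not> (sees (k - 2) k \<or> sees (k - 3) k)" using assms(2) by (auto simp: sees_def)
  moreover have "sees k k" "k \<le> n" using assms(1) by (simp_all add: sees_def)
  ultimately have "\<not> sees w k" using w by (auto simp: upset_imp_def)
  then show "w \<in> {j. sees (Suc k) j}" using assms(2) by (auto simp: sees_def)
next
  fix w assume w: "w \<in> {j. sees (Suc k) j}"
  \<comment> \<open>The cones of \<open>k - 2\<close> and \<open>k - 3\<close> together make up
    \<open>{..k - 2}\<close>, which is exactly what \<open>k\<close> sees besides itself; and
    \<open>w\<close> does not see \<open>k\<close>.\<close>
  have "sees (k - 2) j \<or> sees (k - 3) j" if "sees w j" "sees k j" for j
    using w that assms(2) unfolding sees_def mem_Collect_eq by presburger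
  moreover have "w \<le> n" using w assms(1) by (auto simp: sees_def)
  ultimately show "w \<in> upset_imp sees {..n} {j. sees k j} ({j. sees (k - 2) j} \<union> {j. sees (k - 3) j})"
    by (auto simp: upset_imp_def)
qed

text \<open>The cone of \<open>k + 1\<close> is obtained from those of \<open>k\<close>,
  \<open>k - 2\<close> and \<open>k - 3\<close> by one join and one implication, so the recursion
  can start from the cones of 0 and 1.\<close>

lemma cones_generated:
  assumes C: "closed_subset heyting_language (upset_algebra sees {..n}) C"
    and ab: "set_encode {j. sees 0 j} \<in> C" "set_encode {j. sees 1 j} \<in> C"
    and k: "k \<le> n"
  shows "set_encode {j. sees k j} \<in> C"
  using k
proof (induction k rule: less_induct)
  case (less k)
  interpret finite_preorder sees "{..n}" by (rule finite_preorder_sees)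
  have op: "interp_fun K s [x, y] \<in> C" if "s \<in> {Join, Arrow}" "x \<in> C" "y \<in> C" for s x y
    using C that unfolding closed_subset_heyting by blast
  show ?case
  proof (cases "k \<le> 1")
    case True
    then have "k = 0 \<or> k = 1" by auto
    then show ?thesis using ab by blast
  next
    case False
    then obtain m where m: "k = Suc m" "m \<noteq> 0" by (cases k) auto
    have u: "upset sees {..n} {j. sees i j}" if "i \<le> m" for i
      using that m less.prems by (intro upset_cone) simp
    have "set_encode {j. sees i j} \<in> C" if "i \<le> m" for i
      using less that m by simp
    then have "interp_fun K Arrow [set_encode {j. sees m j},
        interp_fun K Join [set_encode {j. sees (m - 2) j}, set_encode {j. sees (m - 3) j}]] \<in> C"
      by (intro op) simp_all
    then show ?thesis
      using less.prems m u upset_closed(4)[OF u u] by (simp add: interp_upset upset_imp_cone)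
  qed
qed

text \<open>The age supplies a copy of the up-set algebra inside \<open>L\<close>. The generators
  are the cones of 0 and 1: both contain the world 0 seen by all, hence are dense, and they generate
  the \<open>n + 1\<close> distinct cones.\<close>

lemma dense_embedding:
  assumes L: "heyting_fraisse_limit L" and n: "2 \<le> n"
  obtains a b where "dense_element L a" "dense_element L b"
    "n \<le> card (closed_subset heyting_language L hull {a, b})"
proof -
  let ?c = "\<lambda>k. set_encode {j. sees k j}"
  have La: "heyting_algebra L" "age heyting_language L = finite_nontrivial_heyting_algebras"
    using L by (simp_all add: heyting_fraisse_limit_def fraisse_limit_def)
  then have Ls: "is_struct heyting_language L" by (simp add: heyting_algebra_def)
  interpret finite_preorder sees "{..n}" by (rule finite_preorder_sees)
  have "set_encode {} \<noteq> set_encode {..n}" unfolding encode_eq[OF upset_closed(1,2)] by auto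
  then have "nontrivial K" by (simp add: nontrivial_def interp_upset)
  then have "K \<in> age heyting_language L"
    using heyting_algebra_upset finite_universe
    unfolding La(2) finite_nontrivial_heyting_algebras_def by simp
  then obtain B h where B: "fg_substruct heyting_language L B" and h: "isomorphism heyting_language K B h"
    by (auto simp: age_def isomorphic_def)
  then obtain S where S: "S \<subseteq> universe L" "B = L\<lparr>universe := closed_subset heyting_language L hull S\<rparr>"
    by (auto simp: fg_substruct_def)
  have uB: "h ` universe K = closed_subset heyting_language L hull S"
    using h S(2) by (simp add: isomorphism_def bij_betw_def)
  have Bc: "closed_subset heyting_language L (h ` universe K)"
    unfolding uB by (rule closed_subset_hull[OF Ls S(1)])
  have inj: "inj_on h (universe K)" using h by (simp add: isomorphism_def bij_betw_def)
  have h0: "h (interp_fun K s []) = interp_fun L s []" if "s \<in> {Zero, One}" for s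
    using h that unfolding isomorphism_heyting S(2) by auto
  have h2: "h (interp_fun K s [x, y]) = interp_fun L s [h x, h y]"
    if "s \<in> {Meet, Join, Arrow}" "x \<in> universe K" "y \<in> universe K" for s x y
    using h that unfolding isomorphism_heyting S(2) by auto
  have cK: "?c k \<in> universe K" if "k \<le> n" for k
    using upset_cone[OF that] by (auto simp: universe_upset)
  have zK: "interp_fun K Zero [] \<in> universe K" "interp_fun K One [] \<in> universe K"
    using upset_closed(1,2) by (auto simp: universe_upset interp_upset)
  have dense: "dense_element L (h (?c k))" if k: "k < 2" for k
  proof -
    have kn: "k \<le> n" using k n by simp
    have "{j. sees k j} \<noteq> {}" "{j. sees k j} \<noteq> {..n}"
    proof -
      \<comment> \<open>World 2 belongs to neither of the two cones, which keeps them different from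
        the top element; this is why \<open>n\<close> is at least 2.\<close>
      have "sees k 0" "\<not> sees k 2" using k by (auto simp: sees_def)
      then show "{j. sees k j} \<noteq> {}" "{j. sees k j} \<noteq> {..n}" using n by auto
    qed
    then have ne: "?c k \<noteq> interp_fun K Zero []" "?c k \<noteq> interp_fun K One []"
      using upset_cone[OF kn] upset_closed(1,2) by (simp_all add: interp_upset encode_eq del: set_encode_empty)
    \<comment> \<open>Every world sees 0, and 0 lies in the cone, so no world forces the negation of
      the cone.\<close>
    have "upset_imp sees {..n} {j. sees k j} {} = {}"
      by (auto simp: upset_imp_def sees_def)
    then have "interp_fun K Arrow [?c k, interp_fun K Zero []] = interp_fun K Zero []"
      using upset_cone[OF kn] upset_closed(1) by (simp add: interp_upset del: set_encode_empty)
    then have "interp_fun L Arrow [h (?c k), interp_fun L Zero []] = interp_fun L Zero []"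
      using h2[of Arrow "?c k" "interp_fun K Zero []"] h0[of Zero] cK[OF kn] zK by simp
    moreover have "h (?c k) \<in> universe L" using Bc cK[OF kn] by (auto simp: closed_subset_def)
    moreover have "h (?c k) \<noteq> interp_fun L Zero []" "h (?c k) \<noteq> interp_fun L One []"
      using ne h0[of Zero] h0[of One] inj cK[OF kn] zK by (auto simp: inj_on_eq_iff simp flip: h0)
    ultimately show ?thesis by (simp add: dense_element_def)
  qed
  let ?D = "closed_subset heyting_language L hull {h (?c 0), h (?c 1)}"
  have sub: "{h (?c 0), h (?c 1)} \<subseteq> h ` universe K" using cK n by simp
  then have "?D \<subseteq> h ` universe K" using Bc by (rule hull_minimal)
  \<comment> \<open>Since \<open>card\<close> is 0 on infinite sets, a lower bound by counting cones
    requires the generated substructure to be finite.\<close>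
  then have fin: "finite ?D" by (rule finite_subset) (simp add: finite_universe)
  have D: "closed_subset heyting_language L ?D"
    using sub Bc by (intro closed_subset_hull[OF Ls]) (auto simp: closed_subset_def)
  \<comment> \<open>The generated substructure is pulled back to the up-set algebra, where the
    recursion for cones applies.\<close>
  have P: "closed_subset heyting_language K {x \<in> universe K. h x \<in> ?D}"
    using D heyting_algebra_upset h0 h2
    unfolding closed_subset_heyting heyting_algebra_def is_struct_heyting by simp
  have "?c k \<in> {x \<in> universe K. h x \<in> ?D}" if "k \<le> n" for k
    by (rule cones_generated[OF P _ _ that]) (use cK[of 0] cK[of 1] n in \<open>simp_all add: hull_inc\<close>)
  then have im: "(h \<circ> ?c) ` {..n} \<subseteq> ?D" by auto
  have "inj_on ?c {..n}"
  proof (rule inj_onI)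
    fix k l assume "k \<in> {..n}" "l \<in> {..n}" "?c k = ?c l"
    then have "{j. sees k j} = {j. sees l j}" using encode_eq upset_cone by simp
    then have "sees l k = sees k k" "sees k l = sees l l" by blast+
    then have "sees k l" "sees l k" by (simp_all add: sees_def)
    then show "k = l" by (auto simp: sees_def)
  qed
  then have "inj_on (h \<circ> ?c) {..n}" using inj cK by (intro comp_inj_on) (auto intro: inj_on_subset)
  then have "card ((h \<circ> ?c) ` {..n}) = card {..n}" by (rule card_image)
  then have "n \<le> card ?D" using card_mono[OF fin im] by simp
  then show ?thesis using that[OF dense[of 0] dense[of 1]] by simp
qed

theorem theorem2p1:
  fixes L :: "(heyting_symbol, unit, 'a) struct"
  assumes "heyting_fraisse_limit L"
  shows "\<not> roelcke_precompact (Aut heyting_language L) (Aut_topology heyting_language L) \<and>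
    \<not> (\<exists>(\<L> :: ('f, 'r) language) (M :: ('f, 'r, 'm) struct).
        countable_language \<L> \<and> is_struct \<L> M \<and> countable (universe M) \<and> omega_categorical \<L> M \<and>
        isomorphic_topological_groups
          (Aut \<L> M) (Aut_topology \<L> M)
          (Aut heyting_language L) (Aut_topology heyting_language L))"
proof -
  let ?G = "Aut heyting_language L"
  have La: "heyting_algebra L" "ultrahomogeneous heyting_language L"
    using assms by (simp_all add: heyting_fraisse_limit_def fraisse_limit_def)
  have Ls: "is_struct heyting_language L" using La(1) by (simp add: heyting_algebra_def)
  interpret group ?G by (rule group_Aut[OF Ls])
  obtain a0 where a0: "dense_element L a0" using dense_embedding[OF assms order_refl] by blast
  have a0L: "a0 \<in> universe L" using a0 by (simp add: dense_element_def)
  have "\<exists>x\<in>carrier ?G. n \<le> card (closed_subset heyting_language L hull {a0, x a0})" for n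
  proof -
    obtain a b where a: "dense_element L a" and b: "dense_element L b"
      and c: "max 2 n \<le> card (closed_subset heyting_language L hull {a, b})"
      using dense_embedding[OF assms, of "max 2 n"] by auto
    obtain g where g: "g \<in> carrier ?G" "g a0 = a" using dense_conjugate[OF La a0 a] by blast
    obtain k where k: "k \<in> carrier ?G" "k a0 = b" using dense_conjugate[OF La a0 b] by blast
    \<comment> \<open>With this choice \<open>g\<close> moves the pair \<open>a0\<close>,
      \<open>x a0\<close> to the pair \<open>a\<close>, \<open>b\<close>. So pairs with a varying
      first entry are replaced by pairs starting with the fixed \<open>a0\<close>, without changing
      the size of what they generate.\<close>
    define x where "x = inv\<^bsub>?G\<^esub> g \<otimes>\<^bsub>?G\<^esub> k"
    have x: "x \<in> carrier ?G" using g k by (simp add: x_def)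
    have "g \<otimes>\<^bsub>?G\<^esub> x = (g \<otimes>\<^bsub>?G\<^esub> inv\<^bsub>?G\<^esub> g) \<otimes>\<^bsub>?G\<^esub> k"
      unfolding x_def by (rule m_assoc[symmetric]) (use g k in simp_all)
    then have "g \<otimes>\<^bsub>?G\<^esub> x = k" using g k by (simp only: r_inv l_one)
    then have "g (x a0) = b" using mult_Aut_apply[OF g(1) x a0L] k(2) by simp
    then have "g ` {a0, x a0} = {a, b}" using g(2) by simp
    then have "card (closed_subset heyting_language L hull {a0, x a0}) =
        card (closed_subset heyting_language L hull {a, b})"
      using card_isomorphism_hull[OF Ls, of g "{a0, x a0}"] g(1) a0L Aut_closed[OF x a0L]
      by (simp add: carrier_Aut)
    then show ?thesis using x c by (intro bexI[of _ x]) simp_all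
  qed
  then have "\<not> roelcke_precompact ?G (Aut_topology heyting_language L)"
    by (rule not_roelcke_precompact_Aut[OF Ls a0L])
  moreover have "roelcke_precompact ?G (Aut_topology heyting_language L)"
    if "countable_language \<L>" "is_struct \<L> M" "omega_categorical \<L> M"
      "isomorphic_topological_groups (Aut \<L> M) (Aut_topology \<L> M) ?G (Aut_topology heyting_language L)"
    for \<L> :: "('f, 'r) language" and M :: "('f, 'r, 'm) struct"
  proof -
    interpret omega_categorical_struct \<L> M using that by unfold_locales
    show ?thesis
      using group_Aut[OF struct] topspace_Aut group_Aut[OF Ls] roelcke_precompact_Aut that(4)
      by (rule roelcke_precompact_isomorphic)
  qed
  ultimately show ?thesis by blast
qed

end
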